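(* Let $(X,T)$ be a non-invertible topological dynamical system, i.e. $X$ is a compact metric space with distance $d$ and $T:X\to X$ is continuous and onto but not one-to-one. Then for every ergodic measure $\mu$ on $X$ of positive entropy, the set of points of $X$ belonging to a proper asymptotic pair has $\mu$-measure $1$.
   Context: An ergodic measure is a $T$-invariant ergodic Borel probability measure on $X$. A pair $(x,y)\in X\times X$ is asymptotic if $\lim_{n\to+\infty}d(T^nx,T^ny)=0$, and proper if moreover $x\neq y$. A point $x$ belongs to a proper asymptotic pair if there is $y\ne x$ with $(x,y)$ asymptotic. Measurability is understood with respect to the completion of $\mu$. *)

theory Defs
  imports "HOL-Probability.Probability"
begin

definition ergodic_measure :: "('a::topological_space \<Rightarrow> 'a) \<Rightarrow> 'a measure \<Rightarrow> bool" where
  "ergodic_measure T M \<longleftrightarrow>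
     prob_space M \<and> sets M = sets borel \<and>
     T \<in> measurable M M \<and> distr M M T = M \<and>
     (\<forall>A \<in> sets M. T -` A \<inter> space M = A \<longrightarrow> measure M A = 0 \<or> measure M A = 1)"

definition finite_measurable_partition :: "'a measure \<Rightarrow> 'a set set \<Rightarrow> bool" where
  "finite_measurable_partition M P \<longleftrightarrow>
     finite P \<and> P \<subseteq> sets M \<and> partition_on (space M) P"

(* The convention 0 * ln 0 = 0 holds automatically. *)
definition partition_entropy :: "'a measure \<Rightarrow> 'a set set \<Rightarrow> real" where
  "partition_entropy M P = - (\<Sum>A\<in>P. measure M A * ln (measure M A))"

(* The empty preimages are removed because partition_on excludes {} as a block. *)
definition preimage_partition :: "'a measure \<Rightarrow> ('a \<Rightarrow> 'a) \<Rightarrow> 'a set set \<Rightarrow> 'a set set" where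
  "preimage_partition M f P = (\<lambda>A. f -` A \<inter> space M) ` P - {{}}"

(* P \<or> T^{-1} P \<or> ... \<or> T^{-(n-1)} P *)
definition iterated_partition :: "'a measure \<Rightarrow> ('a \<Rightarrow> 'a) \<Rightarrow> 'a set set \<Rightarrow> nat \<Rightarrow> 'a set set" where
  "iterated_partition M T P n =
     common_refinement ((\<lambda>i. preimage_partition M (T ^^ i) P) ` {..<n})"

(* For a T-invariant probability measure and a finite measurable partition the limit
   exists by subadditivity. *)
definition entropy_wrt :: "'a measure \<Rightarrow> ('a \<Rightarrow> 'a) \<Rightarrow> 'a set set \<Rightarrow> real" where
  "entropy_wrt M T P = lim (\<lambda>n. partition_entropy M (iterated_partition M T P n) / real n)"

(* Kolmogorov-Sinai entropy; possibly infinite, hence ereal. *)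
definition measure_entropy :: "'a measure \<Rightarrow> ('a \<Rightarrow> 'a) \<Rightarrow> ereal" where
  "measure_entropy M T =
     (SUP P \<in> {P. finite_measurable_partition M P}. ereal (entropy_wrt M T P))"

definition asymptotic_pair :: "('a::metric_space \<Rightarrow> 'a) \<Rightarrow> 'a \<Rightarrow> 'a \<Rightarrow> bool" where
  "asymptotic_pair T x y \<longleftrightarrow> (\<lambda>n. dist ((T ^^ n) x) ((T ^^ n) y)) \<longlonglongrightarrow> 0"

definition proper_asymptotic_pair :: "('a::metric_space \<Rightarrow> 'a) \<Rightarrow> 'a \<Rightarrow> 'a \<Rightarrow> bool" where
  "proper_asymptotic_pair T x y \<longleftrightarrow> asymptotic_pair T x y \<and> x \<noteq> y"

end

theory Submission
  imports Defs
begin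

text \<open>
  Let \<open>P\<close> be a finite partition with \<open>h(P) = H(P | P\<^sup>-) > 0\<close>, where \<open>P\<^sup>-\<close> is the join of
  \<open>T\<^sup>-\<^sup>i P\<close> over \<open>i \<ge> 1\<close>, and let \<open>Q\<^sub>n\<close> be finite families of small sets covering \<open>X\<close>, of
  diameters tending to 0. Conditioning \<open>P\<close> in addition on the far future of a finite partition \<open>Q\<close>,
  that is on all \<open>T\<^sup>-\<^sup>i Q\<close> with \<open>i \<ge> k\<close>, lowers the conditional entropy by an amount that tends
  to 0 as \<open>k\<close> grows. Choosing \<open>k\<^sub>n\<close> inductively, the events \<open>T\<^sup>-\<^sup>i B\<close> with \<open>B\<close> in \<open>Q\<^sub>n\<close> and
  \<open>i > k\<^sub>n\<close> lie in a countable family \<open>G\<close> with \<open>H(P | G) > 0\<close>, and two points that belong to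
  the same members of \<open>G\<close> are asymptotic. If almost no point had a partner in the same members of
  \<open>G\<close> but in another block of \<open>P\<close>, then a compactness argument on a closed set of almost full
  measure would make \<open>P\<close> almost measurable with respect to finitely many members of \<open>G\<close>, which
  contradicts \<open>H(P | G) > 0\<close>. So proper asymptotic pairs occupy a closed set of positive measure.
  Since \<open>T\<close> is onto, the set of their points contains its preimage under \<open>T\<close>, and ergodicity gives
  measure 1.
\<close>

section \<open>The function \<open>-x ln x\<close> and Cesaro means\<close>

definition eta :: "real \<Rightarrow> real" where
  "eta x = - (x * ln x)"

text \<open>The entropy gained by cutting an event of probability \<open>a + b\<close> into events of probabilities
  \<open>a\<close> and \<open>b\<close>; its superadditivity yields the submodularity of entropy.\<close>
definition split_gain :: "real \<Rightarrow> real \<Rightarrow> real" where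
  "split_gain a b = eta a + eta b - eta (a + b)"

lemma eta_0 [simp]: "eta 0 = 0" and eta_1 [simp]: "eta 1 = 0"
  by (simp_all add: eta_def)

text \<open>The log sum inequality for two terms, a form of the concavity of \<open>ln\<close>.
  Ratios are written as differences of logarithms, and each difference carries a factor that
  vanishes when its first argument is 0. In the main case \<open>ln r \<le> r - 1\<close> is applied
  to \<open>r = v / (u * t)\<close> with \<open>t\<close> the ratio of the totals; for this
  \<open>t\<close> the two error terms cancel.\<close>

lemma log_sum_superadditive:
  fixes a s a' s' :: real
  assumes "0 \<le> a" "a \<le> s" "0 \<le> a'" "a' \<le> s'"
  shows "(a * ln s - a * ln a) + (a' * ln s' - a' * ln a')
    \<le> (a + a') * ln (s + s') - (a + a') * ln (a + a')"
proof -
  consider "a = 0" | "a' = 0" | "0 < a" "0 < a'"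
    using assms by linarith
  then show ?thesis
  proof cases
    case 1
    have "a' * ln s' \<le> a' * ln (s + s')"
      using assms by (cases "a' = 0") (auto intro!: mult_left_mono)
    then show ?thesis using 1 by simp
  next
    case 2
    have "a * ln s \<le> a * ln (s + s')"
      using assms by (cases "a = 0") (auto intro!: mult_left_mono)
    then show ?thesis using 2 by simp
  next
    case 3
    define t where "t = (s + s') / (a + a')"
    have pos: "0 < s" "0 < s'" "0 < t"
      using 3 assms by (auto simp: t_def intro!: divide_pos_pos)
    have bound: "u * (ln v - ln u - ln t) \<le> v / t - u" if "0 < u" "0 < v" for u v
    proof -
      have "ln v - ln u - ln t = ln (v / u / t)"
        using that pos by (simp add: ln_div ln_mult)
      also have "\<dots> \<le> v / u / t - 1"
        using that pos by (intro ln_le_minus_one) auto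
      finally have "u * (ln v - ln u - ln t) \<le> u * (v / u / t - 1)"
        using that by (intro mult_left_mono) auto
      also have "\<dots> = v / t - u"
        using that pos by (simp add: field_simps)
      finally show ?thesis .
    qed
    have "(s + s') / t = a + a'"
      using 3 assms by (simp add: t_def)
    then have "a * (ln s - ln a - ln t) + a' * (ln s' - ln a' - ln t) \<le> 0"
      using bound[of a s] bound[of a' s'] 3 pos by (simp add: add_divide_distrib)
    moreover have "ln t = ln (s + s') - ln (a + a')"
      using 3 pos by (simp add: t_def ln_div)
    ultimately show ?thesis by (simp add: algebra_simps)
  qed
qed

text \<open>\<open>split_gain a b\<close> is
  \<open>a * (ln (a + b) - ln a) + b * (ln (a + b) - ln b)\<close>, and the log sum inequality
  applies to each of the two terms.\<close>

lemma split_gain_superadditive: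
  assumes "0 \<le> a" "0 \<le> b" "0 \<le> a'" "0 \<le> b'"
  shows "split_gain a b + split_gain a' b' \<le> split_gain (a + a') (b + b')"
  using log_sum_superadditive[of a "a + b" a' "a' + b'"]
    log_sum_superadditive[of b "a + b" b' "a' + b'"] assms
  by (simp add: split_gain_def eta_def algebra_simps)

lemma split_gain_nonneg:
  assumes "0 \<le> a" "0 \<le> b"
  shows "0 \<le> split_gain a b"
proof -
  have "x * ln x \<le> x * ln (a + b)" if "0 \<le> x" "x \<le> a + b" for x
    using that by (cases "x = 0") (auto intro!: mult_left_mono)
  from this[of a] this[of b] show ?thesis
    using assms by (simp add: split_gain_def eta_def algebra_simps)
qed

text \<open>Away from 0 this is continuity of \<open>ln\<close>; at 0 it is the one-sided limit of
  \<open>x * ln x\<close>, which is why the \<open>f n\<close> must be nonnegative.\<close>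

lemma tendsto_eta:
  assumes "(f \<longlongrightarrow> x) F" "0 \<le> x" "\<And>n. 0 \<le> f n"
  shows "((\<lambda>n. eta (f n)) \<longlongrightarrow> eta x) F"
proof (cases "x = 0")
  case False
  then show ?thesis
    unfolding eta_def using assms by (intro tendsto_intros) auto
next
  case True
  have "((\<lambda>x::real. x * ln x) \<longlongrightarrow> 0) (at_right 0)"
    by real_asymp
  then have "((\<lambda>x. - (x * ln x)) \<longlongrightarrow> - 0) (at (0::real) within {0..})"
    by (intro tendsto_minus) (simp add: at_within_Ici_at_right)
  then have "continuous (at 0 within {0..}) eta"
    by (simp add: continuous_within eta_def[abs_def])
  then show ?thesis
    unfolding True using assms True
    by (intro continuous_within_tendsto_compose'[where S = "{0..}" and f = eta]) auto
qed

lemma cesaro_mean_zero: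
  fixes d :: "nat \<Rightarrow> real"
  assumes "d \<longlonglongrightarrow> 0"
  shows "(\<lambda>n. (\<Sum>i<n. d i) / real n) \<longlonglongrightarrow> 0"
proof (rule LIMSEQ_I)
  fix e :: real assume e: "0 < e"
  obtain N where N: "\<And>n. n \<ge> N \<Longrightarrow> \<bar>d n\<bar> < e / 2"
    using LIMSEQ_D[OF assms, of "e / 2"] e by auto
  define C where "C = (\<Sum>i<N. \<bar>d i\<bar>)"
  obtain K where K: "2 * C / e < real K"
    using reals_Archimedean2 by blast
  have "norm ((\<Sum>i<n. d i) / real n - 0) < e" if n: "n \<ge> max (max N K) 1" for n
  proof -
    have "\<bar>\<Sum>i<n. d i\<bar> \<le> (\<Sum>i<n. \<bar>d i\<bar>)"
      by (rule sum_abs)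
    also have "\<dots> = C + (\<Sum>i\<in>{N..<n}. \<bar>d i\<bar>)"
      unfolding C_def using n by (subst sum.union_disjoint[symmetric]) (auto intro!: sum.cong)
    also have "\<dots> \<le> C + (\<Sum>i\<in>{N..<n}. e / 2)"
      using N by (intro add_left_mono sum_mono) (auto intro: less_imp_le)
    also have "\<dots> \<le> C + real n * (e / 2)"
      using e by (auto intro!: mult_right_mono)
    also have "\<dots> < real n * e"
    proof -
      have "2 * C / e < real n"
        using K n by (meson less_le_trans max.boundedE of_nat_mono)
      then show ?thesis using e by (simp add: field_simps)
    qed
    finally show ?thesis using n by (simp add: field_simps)
  qed
  then show "\<exists>no. \<forall>n\<ge>no. norm ((\<Sum>i<n. d i) / real n - 0) < e" by blast
qed

lemma cesaro_mean:
  fixes d :: "nat \<Rightarrow> real"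
  assumes "d \<longlonglongrightarrow> l"
  shows "(\<lambda>n. (\<Sum>i<n. d i) / real n) \<longlonglongrightarrow> l"
proof -
  have "(\<lambda>n. (\<Sum>i<n. d i - l) / real n + l) \<longlonglongrightarrow> 0 + l"
    using assms by (intro tendsto_add cesaro_mean_zero tendsto_const) (simp add: LIM_zero)
  moreover have "eventually (\<lambda>n. (\<Sum>i<n. d i - l) / real n + l = (\<Sum>i<n. d i) / real n) sequentially"
    using eventually_gt_at_top[of 0]
    by eventually_elim (simp add: sum_subtractf field_simps)
  ultimately show ?thesis
    by (simp add: tendsto_cong)
qed

section \<open>Entropy of finite families of events\<close>

lemma finite_subset_Union_incseq:
  fixes G :: "nat \<Rightarrow> 'b set"
  assumes "finite F" "F \<subseteq> (\<Union>n. G n)" "incseq G"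
  obtains n where "F \<subseteq> G n"
proof -
  have "\<exists>n. F \<subseteq> G n"
    using assms(1,2)
  proof (induction F rule: finite_induct)
    case (insert x F)
    then obtain m n where "F \<subseteq> G m" "x \<in> G n" by auto
    then have "insert x F \<subseteq> G (max m n)"
      using incseqD[OF assms(3), of m "max m n"] incseqD[OF assms(3), of n "max m n"] by auto
    then show ?case ..
  qed simp
  then show thesis using that by blast
qed

text \<open>For \<open>S\<close> in \<open>Pow F\<close> these are the atoms of the partition
  generated by \<open>F\<close>, up to empty sets, which are harmless because
  \<open>eta 0 = 0\<close>; for every other \<open>S\<close> the cell is empty.\<close>

definition cell :: "'a set set \<Rightarrow> 'a set set \<Rightarrow> 'a set" where
  "cell F S = {x. {E \<in> F. x \<in> E} = S}"

lemma cell_insert: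
  assumes "E \<notin> F" "S \<subseteq> F"
  shows "cell (insert E F) S = cell F S - E"
    and "cell (insert E F) (insert E S) = cell F S \<inter> E"
  using assms by (auto simp: cell_def)

lemma sum_Pow_insert:
  fixes g :: "'b set \<Rightarrow> real"
  assumes "finite F" "E \<notin> F"
  shows "(\<Sum>S\<in>Pow (insert E F). g S) = (\<Sum>S\<in>Pow F. g S + g (insert E S))"
proof -
  have "inj_on (insert E) (Pow F)"
    using assms by (auto simp: inj_on_def)
  moreover have "Pow F \<inter> insert E ` Pow F = {}"
    using assms by auto
  ultimately show ?thesis
    using assms by (simp add: Pow_insert sum.union_disjoint sum.reindex sum.distrib)
qed

locale prob_space_UNIV = prob_space M for M :: "'a measure" +
  assumes space_UNIV [simp]: "space M = UNIV"
begin

text \<open>A finite family of events stands for the partition it generates, so that the join of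
  partitions becomes the union of families.\<close>
definition family_entropy :: "'a set set \<Rightarrow> real" where
  "family_entropy F = (\<Sum>S\<in>Pow F. eta (prob (cell F S)))"

text \<open>Stands for the entropy of \<open>A\<close> given the sigma-algebra generated by
  \<open>G\<close>, where \<open>G\<close> may be infinite, without conditional expectations. By
  \<open>family_entropy_antimono_diff\<close> the differences decrease as \<open>F\<close> grows, so
  the infimum is a limit along finite subfamilies.\<close>

definition cond_entropy :: "'a set set \<Rightarrow> 'a set set \<Rightarrow> real" where
  "cond_entropy A G =
     (INF F\<in>{F. finite F \<and> F \<subseteq> G}. family_entropy (A \<union> F) - family_entropy F)"

lemma sets_cell:
  assumes "finite F" "F \<subseteq> sets M"
  shows "cell F S \<in> sets M"
proof (cases "S \<subseteq> F")
  case True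
  then have "cell F S = (\<Inter>E\<in>F. if E \<in> S then E else UNIV - E) \<inter> UNIV"
    by (auto simp: cell_def split: if_splits)
  also have "\<dots> \<in> sets M"
  proof (cases "F = {}")
    case True
    then show ?thesis using sets.top[of M] by simp
  next
    case False
    then show ?thesis
      using assms sets.compl_sets[of _ M]
      by (intro sets.Int sets.finite_INT) (auto simp: sets.top[of M, simplified])
  qed
  finally show ?thesis .
next
  case False
  then have "cell F S = {}" by (auto simp: cell_def)
  then show ?thesis by simp
qed

lemma family_entropy_empty [simp]: "family_entropy {} = 0"
  using prob_space by (simp add: family_entropy_def cell_def)

lemma family_entropy_insert:
  assumes "finite F" "F \<subseteq> sets M" "E \<in> sets M" "E \<notin> F"
  shows "family_entropy (insert E F) - family_entropy F
    = (\<Sum>S\<in>Pow F. split_gain (prob (cell F S \<inter> E)) (prob (cell F S - E)))"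
proof -
  have "prob (cell F S) = prob (cell F S \<inter> E) + prob (cell F S - E)" for S
    using finite_measure_Diff'[OF sets_cell[OF assms(1,2)] assms(3)] by simp
  moreover have "family_entropy (insert E F)
      = (\<Sum>S\<in>Pow F. eta (prob (cell F S - E)) + eta (prob (cell F S \<inter> E)))"
    unfolding family_entropy_def sum_Pow_insert[OF assms(1,4)]
    using assms(4) by (intro sum.cong) (auto simp: cell_insert)
  ultimately show ?thesis
    by (simp add: family_entropy_def split_gain_def sum_subtractf[symmetric] add.commute)
qed

lemma family_entropy_insert_ge:
  assumes "finite F" "F \<subseteq> sets M" "E \<in> sets M"
  shows "family_entropy F \<le> family_entropy (insert E F)"
proof (cases "E \<in> F")
  case False
  then show ?thesis
    using family_entropy_insert[OF assms False]
    by (smt (verit) split_gain_nonneg sum_nonneg measure_nonneg)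
qed (simp add: insert_absorb)

text \<open>When \<open>D\<close> and \<open>E\<close> are new, \<open>D\<close> cuts each cell of
  \<open>F\<close> in two, and by superadditivity of \<open>split_gain\<close> the gains from
  \<open>E\<close> on the two pieces add up to at most the gain on the whole cell.\<close>

lemma family_entropy_submodular_insert:
  assumes F: "finite F" "F \<subseteq> sets M" and E: "E \<in> sets M" and D: "D \<in> sets M"
  shows "family_entropy (insert E (insert D F)) - family_entropy (insert D F)
    \<le> family_entropy (insert E F) - family_entropy F"
proof -
  consider "E \<in> insert D F" | "E \<notin> insert D F" "D \<in> F" | "E \<notin> insert D F" "D \<notin> F"
    by blast
  then show ?thesis
  proof cases
    case 1
    then have "insert E (insert D F) = insert D F" by blast
    then show ?thesis
      using family_entropy_insert_ge[OF F E] by simp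
  next
    case 2
    then show ?thesis by (simp add: insert_absorb)
  next
    case 3
    let ?g = "\<lambda>A. split_gain (prob (A \<inter> E)) (prob (A - E))"
    have *: "?g (A - D) + ?g (A \<inter> D) \<le> ?g A" if A: "A \<in> sets M" for A
    proof -
      have "prob (A \<inter> E) = prob ((A - D) \<inter> E) + prob ((A \<inter> D) \<inter> E)"
        using A E D by (subst finite_measure_Union[symmetric]) (auto intro!: arg_cong[of _ _ prob])
      moreover have "prob (A - E) = prob ((A - D) - E) + prob ((A \<inter> D) - E)"
        using A E D by (subst finite_measure_Union[symmetric]) (auto intro!: arg_cong[of _ _ prob])
      ultimately show ?thesis
        using split_gain_superadditive[of "prob ((A - D) \<inter> E)" "prob ((A - D) - E)"
          "prob ((A \<inter> D) \<inter> E)" "prob ((A \<inter> D) - E)"] by simp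
    qed
    have "family_entropy (insert E (insert D F)) - family_entropy (insert D F)
      = (\<Sum>S\<in>Pow F. ?g (cell (insert D F) S) + ?g (cell (insert D F) (insert D S)))"
      using 3 F D E by (subst family_entropy_insert) (auto simp: sum_Pow_insert)
    also have "\<dots> = (\<Sum>S\<in>Pow F. ?g (cell F S - D) + ?g (cell F S \<inter> D))"
      using 3 by (intro sum.cong) (auto simp: cell_insert)
    also have "\<dots> \<le> (\<Sum>S\<in>Pow F. ?g (cell F S))"
      by (intro sum_mono * sets_cell F)
    also have "\<dots> = family_entropy (insert E F) - family_entropy F"
      using 3 F E by (subst family_entropy_insert) auto
    finally show ?thesis .
  qed
qed

lemma family_entropy_mono:
  assumes "finite G" "G \<subseteq> sets M" "F \<subseteq> G"
  shows "family_entropy F \<le> family_entropy G"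
proof -
  have "finite F" using assms finite_subset by blast
  have "finite D \<Longrightarrow> D \<subseteq> sets M \<Longrightarrow> family_entropy F \<le> family_entropy (D \<union> F)" for D
  proof (induction D rule: finite_induct)
    case (insert E D)
    then show ?case
      using family_entropy_insert_ge[of "D \<union> F" E] assms \<open>finite F\<close> by force
  qed simp
  from this[of G] show ?thesis
    using assms by (simp add: Un_absorb2)
qed

lemma family_entropy_submodular:
  assumes A: "finite A" "A \<subseteq> sets M" and F: "finite F" "F \<subseteq> sets M"
    and D: "finite D" "D \<subseteq> sets M"
  shows "family_entropy (A \<union> D \<union> F) - family_entropy (D \<union> F)
    \<le> family_entropy (A \<union> F) - family_entropy F"
proof -
  have single: "family_entropy (insert E (D \<union> F)) - family_entropy (D \<union> F)
    \<le> family_entropy (insert E F) - family_entropy F"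
    if "E \<in> sets M" and F: "finite F" "F \<subseteq> sets M" for E F
    using D
  proof (induction D rule: finite_induct)
    case (insert d D)
    then show ?case
      using family_entropy_submodular_insert[of "D \<union> F" E d] that by force
  qed simp
  show ?thesis
    using A
  proof (induction A rule: finite_induct)
    case (insert E A)
    then show ?case
      using single[of E "A \<union> F"] F by (force simp: Un_ac)
  qed simp
qed

lemma family_entropy_antimono_diff:
  assumes "finite A" "A \<subseteq> sets M" "finite G" "G \<subseteq> sets M" "F \<subseteq> G"
  shows "family_entropy (A \<union> G) - family_entropy G \<le> family_entropy (A \<union> F) - family_entropy F"
proof -
  have "finite F" "F \<subseteq> sets M" "G \<union> F = G" "A \<union> G \<union> F = A \<union> G"
    using assms by (auto intro: finite_subset)
  then show ?thesis
    using family_entropy_submodular[of A F G] assms by simp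
qed

lemma cond_entropy_empty [simp]: "cond_entropy {} G = 0"
proof -
  have "{F. finite F \<and> F \<subseteq> G} \<noteq> {}" by blast
  then show ?thesis by (simp add: cond_entropy_def)
qed

lemma cond_entropy_bdd_below:
  assumes "finite A" "A \<subseteq> sets M" "G \<subseteq> sets M"
  shows "bdd_below ((\<lambda>F. family_entropy (A \<union> F) - family_entropy F) ` {F. finite F \<and> F \<subseteq> G})"
  using assms by (intro bdd_belowI[of _ 0]) (force intro!: family_entropy_mono)

lemma cond_entropy_le:
  assumes "finite A" "A \<subseteq> sets M" "G \<subseteq> sets M" "finite F" "F \<subseteq> G"
  shows "cond_entropy A G \<le> family_entropy (A \<union> F) - family_entropy F"
  unfolding cond_entropy_def using assms
  by (intro cINF_lower cond_entropy_bdd_below) auto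

lemma cond_entropy_ge:
  assumes "\<And>F. finite F \<Longrightarrow> F \<subseteq> G \<Longrightarrow> c \<le> family_entropy (A \<union> F) - family_entropy F"
  shows "c \<le> cond_entropy A G"
  unfolding cond_entropy_def using assms by (intro cINF_greatest) auto

lemma cond_entropy_approx:
  assumes "c > cond_entropy A G"
  obtains F where "finite F" "F \<subseteq> G" "family_entropy (A \<union> F) - family_entropy F < c"
  using assms cond_entropy_ge[of G c A] by (meson not_le)

lemma cond_entropy_antimono:
  assumes "finite A" "A \<subseteq> sets M" "G' \<subseteq> sets M" "G \<subseteq> G'"
  shows "cond_entropy A G' \<le> cond_entropy A G"
  using assms by (intro cond_entropy_ge cond_entropy_le) auto

text \<open>The chain rule. For one finite conditioning family it is a telescoping identity; what
  needs proof is that a single finite subfamily of \<open>G\<close> can serve both infima.\<close>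

lemma cond_entropy_Un:
  assumes A: "finite A" "A \<subseteq> sets M" and B: "finite B" "B \<subseteq> sets M" and G: "G \<subseteq> sets M"
  shows "cond_entropy (A \<union> B) G = cond_entropy A G + cond_entropy B (A \<union> G)"
proof (rule antisym)
  show "cond_entropy (A \<union> B) G \<le> cond_entropy A G + cond_entropy B (A \<union> G)"
  proof (rule field_le_epsilon)
    fix e :: real assume "0 < e"
    then obtain F1 F2 where F1: "finite F1" "F1 \<subseteq> G"
        "family_entropy (A \<union> F1) - family_entropy F1 < cond_entropy A G + e / 2"
      and F2: "finite F2" "F2 \<subseteq> A \<union> G"
        "family_entropy (B \<union> F2) - family_entropy F2 < cond_entropy B (A \<union> G) + e / 2"
      using cond_entropy_approx[of A G "cond_entropy A G + e / 2"]
        cond_entropy_approx[of B "A \<union> G" "cond_entropy B (A \<union> G) + e / 2"]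
      by (metis field_sum_of_halves less_add_same_cancel1 half_gt_zero)
    \<comment> \<open>Members of \<open>F2\<close> outside \<open>G\<close> lie in \<open>A\<close>,
      hence \<open>F2 \<subseteq> A \<union> F\<close> although \<open>F\<close> uses events of
      \<open>G\<close> only.\<close>
    define F where "F = F1 \<union> (F2 \<inter> G)"
    have F: "finite F" "F \<subseteq> G" "F \<subseteq> sets M"
      using F1 F2 G by (auto simp: F_def)
    have "cond_entropy (A \<union> B) G \<le> family_entropy (A \<union> B \<union> F) - family_entropy F"
      using A B G F by (intro cond_entropy_le) auto
    also have "\<dots> = (family_entropy (B \<union> (A \<union> F)) - family_entropy (A \<union> F))
        + (family_entropy (A \<union> F) - family_entropy F)"
      by (simp add: Un_ac)
    also have "\<dots> \<le> (family_entropy (B \<union> F2) - family_entropy F2)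
        + (family_entropy (A \<union> F1) - family_entropy F1)"
      using A B F F1 F2 by (intro add_mono family_entropy_antimono_diff) (auto simp: F_def)
    finally show "cond_entropy (A \<union> B) G \<le> cond_entropy A G + cond_entropy B (A \<union> G) + e"
      using F1 F2 by simp
  qed
  show "cond_entropy A G + cond_entropy B (A \<union> G) \<le> cond_entropy (A \<union> B) G"
  proof (rule cond_entropy_ge)
    fix F assume F: "finite F" "F \<subseteq> G"
    have "cond_entropy A G \<le> family_entropy (A \<union> F) - family_entropy F"
      using A G F by (intro cond_entropy_le)
    moreover have "cond_entropy B (A \<union> G) \<le> family_entropy (B \<union> (A \<union> F)) - family_entropy (A \<union> F)"
      using A B G F by (intro cond_entropy_le) auto
    ultimately show "cond_entropy A G + cond_entropy B (A \<union> G)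
        \<le> family_entropy (A \<union> B \<union> F) - family_entropy F"
      by (simp add: Un_ac)
  qed
qed

lemma cond_entropy_incseq_Union:
  fixes G :: "nat \<Rightarrow> 'a set set"
  assumes A: "finite A" "A \<subseteq> sets M" and G: "\<And>n. G n \<subseteq> sets M" and "incseq G"
    and c: "\<And>n. c \<le> cond_entropy A (G n)"
  shows "c \<le> cond_entropy A (\<Union>n. G n)"
proof (rule cond_entropy_ge)
  fix F assume F: "finite F" "F \<subseteq> (\<Union>n. G n)"
  then obtain n where "F \<subseteq> G n"
    using finite_subset_Union_incseq[OF F(1,2) \<open>incseq G\<close>] by blast
  then show "c \<le> family_entropy (A \<union> F) - family_entropy F"
    using cond_entropy_le[OF A G F(1)] c by (meson order_trans)
qed

end

section \<open>Entropy of a measure-preserving surjection\<close>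

locale surj_mpt = prob_space_UNIV M for M :: "'a measure" +
  fixes T :: "'a \<Rightarrow> 'a"
  assumes T_measurable: "T \<in> measurable M M"
    and T_invariant: "distr M M T = M"
    and T_surj: "surj T"
begin

definition pre :: "nat \<Rightarrow> 'a set set \<Rightarrow> 'a set set" where
  "pre k F = (vimage (T ^^ k)) ` F"

definition block :: "nat \<Rightarrow> 'a set set \<Rightarrow> 'a set set" where
  "block n F = (\<Union>i<n. pre i F)"

text \<open>The index starts at 1 so that \<open>F\<close> itself is left out;
  \<open>cond_entropy F (past F)\<close> is then the entropy rate of \<open>F\<close>, as
  \<open>block_entropy_limit\<close> shows.\<close>

definition past :: "'a set set \<Rightarrow> 'a set set" where
  "past F = (\<Union>i. pre (Suc i) F)"

definition full :: "'a set set \<Rightarrow> 'a set set" where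
  "full F = (\<Union>i. pre i F)"

lemma vimage_funpow_Suc: "(T ^^ Suc k) -` A = T -` ((T ^^ k) -` A)"
  by (simp add: vimage_comp funpow_Suc_right del: funpow.simps)

lemma vimage_funpow_sets:
  assumes "A \<in> sets M"
  shows "(T ^^ k) -` A \<in> sets M"
proof (induction k)
  case (Suc k)
  then show ?case
    using measurable_sets[OF T_measurable Suc]
    by (simp add: vimage_funpow_Suc del: funpow.simps)
qed (use assms in simp)

lemma prob_vimage_funpow:
  assumes "A \<in> sets M"
  shows "prob ((T ^^ k) -` A) = prob A"
proof (induction k)
  case (Suc k)
  have "prob (T -` ((T ^^ k) -` A)) = measure (distr M M T) ((T ^^ k) -` A)"
    using vimage_funpow_sets[OF assms] by (subst measure_distr[OF T_measurable]) auto
  then show ?case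
    using Suc T_invariant by (simp add: vimage_funpow_Suc del: funpow.simps)
qed simp

text \<open>Surjectivity keeps distinct events distinct under preimages, so sums over
  \<open>Pow F\<close> can be reindexed as sums over \<open>Pow (pre k F)\<close>, and nonempty
  blocks stay nonempty.\<close>

lemma inj_vimage_funpow: "inj (vimage (T ^^ k))"
proof -
  have "surj (T ^^ k)"
    using T_surj by (rule surj_fn)
  then show ?thesis
    by (metis injI surj_image_vimage_eq)
qed

lemma pre_subset_sets: "F \<subseteq> sets M \<Longrightarrow> pre k F \<subseteq> sets M"
  using vimage_funpow_sets by (auto simp: pre_def)

lemma pre_0 [simp]: "pre 0 F = F"
  by (simp add: pre_def)

lemma pre_empty [simp]: "pre k {} = {}"
  by (simp add: pre_def)

lemma pre_pre: "pre j (pre k F) = pre (k + j) F"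
  by (simp add: pre_def image_image vimage_comp funpow_add)

lemma pre_Un: "pre k (F \<union> G) = pre k F \<union> pre k G"
  by (auto simp: pre_def)

lemma pre_UN: "pre k (\<Union>i\<in>I. F i) = (\<Union>i\<in>I. pre k (F i))"
  by (auto simp: pre_def)

lemma finite_pre: "finite F \<Longrightarrow> finite (pre k F)"
  by (simp add: pre_def)

lemma finite_block: "finite F \<Longrightarrow> finite (block n F)"
  by (simp add: block_def finite_pre)

lemma block_subset_sets: "F \<subseteq> sets M \<Longrightarrow> block n F \<subseteq> sets M"
  using pre_subset_sets by (auto simp: block_def)

lemma past_subset_sets: "F \<subseteq> sets M \<Longrightarrow> past F \<subseteq> sets M"
  using pre_subset_sets by (auto simp: past_def)

lemma full_subset_sets: "F \<subseteq> sets M \<Longrightarrow> full F \<subseteq> sets M"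
  using pre_subset_sets by (auto simp: full_def)

lemma block_0 [simp]: "block 0 F = {}"
  by (simp add: block_def)

lemma block_Suc: "block (Suc n) F = pre 1 (block n F) \<union> F"
  unfolding block_def pre_UN pre_pre
  by (simp only: lessThan_Suc_eq_insert_0 UN_insert image_image pre_0 UN_simps) auto

lemma block_Un: "block n (F \<union> G) = block n F \<union> block n G"
  by (auto simp: block_def pre_Un)

lemma full_Un: "full (F \<union> G) = full F \<union> full G"
  by (auto simp: full_def pre_Un)

lemma full_empty [simp]: "full {} = {}"
  by (simp add: full_def)

lemma past_eq_block: "past F = pre 1 (block n F) \<union> pre (Suc n) (full F)"
proof -
  have "{..<n} \<union> range (\<lambda>i. i + n) = UNIV"
    by (auto simp: image_iff) (metis le_add_diff_inverse2 not_less)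
  then have "past F = (\<Union>i\<in>{..<n} \<union> range (\<lambda>i. i + n). pre (Suc i) F)"
    by (simp add: past_def)
  also have "\<dots> = pre 1 (block n F) \<union> pre (Suc n) (full F)"
    by (simp add: block_def full_def pre_UN pre_pre UN_Un image_image del: UN_simps)
  finally show ?thesis .
qed

lemma family_entropy_pre:
  assumes F: "F \<subseteq> sets M" "finite F"
  shows "family_entropy (pre k F) = family_entropy F"
proof -
  let ?g = "vimage (T ^^ k)"
  have "cell (pre k F) (?g ` S) = ?g (cell F S)" if "S \<subseteq> F" for S
  proof -
    have "{E \<in> pre k F. x \<in> E} = ?g ` {E \<in> F. (T ^^ k) x \<in> E}" for x
      by (auto simp: pre_def)
    then show ?thesis
      using inj_vimage_funpow[of k] by (auto simp: cell_def inj_image_eq_iff)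
  qed
  then have "eta (prob (cell (pre k F) (?g ` S))) = eta (prob (cell F S))" if "S \<in> Pow F" for S
    using that F sets_cell by (simp add: prob_vimage_funpow)
  moreover have "inj_on (image ?g) (Pow F)"
    using inj_vimage_funpow[of k] by (auto simp: inj_on_def inj_image_eq_iff)
  moreover have "Pow (pre k F) = image ?g ` Pow F"
    by (simp add: pre_def image_Pow_surj)
  ultimately show ?thesis
    unfolding family_entropy_def by (simp add: sum.reindex)
qed

lemma cond_entropy_pre:
  assumes A: "finite A" "A \<subseteq> sets M" and G: "G \<subseteq> sets M"
  shows "cond_entropy (pre k A) (pre k G) = cond_entropy A G"
proof (rule antisym)
  show "cond_entropy (pre k A) (pre k G) \<le> cond_entropy A G"
  proof (rule cond_entropy_ge)
    fix F assume F: "finite F" "F \<subseteq> G"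
    have "cond_entropy (pre k A) (pre k G) \<le> family_entropy (pre k A \<union> pre k F) - family_entropy (pre k F)"
      using A G F pre_subset_sets by (intro cond_entropy_le) (auto simp: pre_def)
    also have "\<dots> = family_entropy (A \<union> F) - family_entropy F"
      using A G F by (simp add: pre_Un[symmetric] family_entropy_pre)
    finally show "cond_entropy (pre k A) (pre k G) \<le> family_entropy (A \<union> F) - family_entropy F" .
  qed
  show "cond_entropy A G \<le> cond_entropy (pre k A) (pre k G)"
  proof (rule cond_entropy_ge)
    fix F' assume "finite F'" "F' \<subseteq> pre k G"
    then obtain F where F: "finite F" "F \<subseteq> G" "F' = pre k F"
      unfolding pre_def by (meson finite_subset_image)
    have "cond_entropy A G \<le> family_entropy (A \<union> F) - family_entropy F"
      using A G F by (intro cond_entropy_le) auto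
    also have "\<dots> = family_entropy (pre k A \<union> F') - family_entropy F'"
      using A G F by (simp add: pre_Un[symmetric] family_entropy_pre)
    finally show "cond_entropy A G \<le> family_entropy (pre k A \<union> F') - family_entropy F'" .
  qed
qed

text \<open>\<open>block (Suc n) F\<close> is \<open>F\<close> joined with a shifted copy of
  \<open>block n F\<close>, and by invariance the shift does not change entropy. So the increments
  are the entropies of \<open>F\<close> given the finite parts \<open>B n\<close> that exhaust
  \<open>past F\<close>; they converge, and so do their Cesaro means.\<close>

lemma block_entropy_limit:
  assumes F: "finite F" "F \<subseteq> sets M"
  shows "(\<lambda>n. family_entropy (block n F) / real n) \<longlonglongrightarrow> cond_entropy F (past F)"
proof -
  define B where "B n = pre 1 (block n F)" for n
  define d where "d n = family_entropy (F \<union> B n) - family_entropy (B n)" for n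
  have B: "finite (B n)" "B n \<subseteq> sets M" "B n \<subseteq> past F" for n
    using F finite_pre finite_block pre_subset_sets block_subset_sets past_eq_block[of F n]
    by (auto simp: B_def)
  have "incseq B"
    by (fastforce simp: incseq_def B_def block_def pre_UN pre_pre)
  have d: "d n = family_entropy (block (Suc n) F) - family_entropy (block n F)" for n
    using F by (simp add: d_def B_def block_Suc family_entropy_pre block_subset_sets finite_block Un_commute)
  have "d \<longlonglongrightarrow> cond_entropy F (past F)"
  proof (rule LIMSEQ_I)
    fix e :: real assume "0 < e"
    then obtain D where D: "finite D" "D \<subseteq> past F"
      "family_entropy (F \<union> D) - family_entropy D < cond_entropy F (past F) + e"
      using cond_entropy_approx[of F "past F" "cond_entropy F (past F) + e"] by auto
    have "past F = (\<Union>n. B n)"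
      by (auto simp: past_def B_def block_def pre_UN pre_pre)
    then obtain N where N: "D \<subseteq> B N"
      using finite_subset_Union_incseq[OF D(1) _ \<open>incseq B\<close>] D(2) by metis
    have "norm (d n - cond_entropy F (past F)) < e" if "n \<ge> N" for n
    proof -
      have "D \<subseteq> B n"
        using N that \<open>incseq B\<close> by (meson incseqD order_trans)
      then have "d n \<le> family_entropy (F \<union> D) - family_entropy D"
        unfolding d_def using F B by (intro family_entropy_antimono_diff) auto
      moreover have "cond_entropy F (past F) \<le> d n"
        unfolding d_def using F B past_subset_sets by (intro cond_entropy_le) auto
      ultimately show ?thesis using D by simp
    qed
    then show "\<exists>no. \<forall>n\<ge>no. norm (d n - cond_entropy F (past F)) < e" by blast
  qed
  moreover have "family_entropy (block n F) = (\<Sum>i<n. d i)" for n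
    unfolding d using sum_lessThan_telescope[of "\<lambda>n. family_entropy (block n F)" n] by simp
  ultimately show ?thesis
    by (simp add: cesaro_mean)
qed

section \<open>Conditioning on the far future\<close>

text \<open>The chain rule peels off the event family at time 0; what remains is a shifted copy of
  the case \<open>n\<close>, and invariance removes the shift.\<close>

lemma cond_entropy_block:
  assumes R: "finite R" "R \<subseteq> sets M" and Q: "Q \<subseteq> sets M"
  shows "cond_entropy (block n R) (pre n (full (R \<union> Q)))
    = (\<Sum>m<n. cond_entropy R (past R \<union> pre (Suc m) (full Q)))"
proof (induction n)
  case 0
  show ?case by simp
next
  case (Suc n)
  let ?Z = "full (R \<union> Q)"
  have Z: "?Z \<subseteq> sets M"
    using R Q full_subset_sets by simp
  have "cond_entropy (block (Suc n) R) (pre (Suc n) ?Z)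
      = cond_entropy (pre 1 (block n R)) (pre (Suc n) ?Z)
        + cond_entropy R (pre 1 (block n R) \<union> pre (Suc n) ?Z)"
    unfolding block_Suc using R Z
    by (intro cond_entropy_Un finite_pre finite_block pre_subset_sets block_subset_sets)
  also have "cond_entropy (pre 1 (block n R)) (pre (Suc n) ?Z) = cond_entropy (block n R) (pre n ?Z)"
    using cond_entropy_pre[of "block n R" "pre n ?Z" 1] R Z
    by (simp add: pre_pre pre_subset_sets block_subset_sets finite_block)
  \<comment> \<open>For \<open>R\<close> the times 1 to \<open>n\<close> and the times from
    \<open>Suc n\<close> on make up all of \<open>past R\<close>; for \<open>Q\<close> only the
    times from \<open>Suc n\<close> on are present.\<close>
  also have "pre 1 (block n R) \<union> pre (Suc n) ?Z = past R \<union> pre (Suc n) (full Q)"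
    unfolding past_eq_block[of R n] full_Un pre_Un by blast
  finally show ?case using Suc by simp
qed

text \<open>With \<open>Q = {}\<close> every summand in \<open>cond_entropy_block\<close> equals
  \<open>cond_entropy F (past F)\<close>.\<close>

lemma family_entropy_block_ge:
  assumes F: "finite F" "F \<subseteq> sets M"
  shows "cond_entropy (block n F) (pre n (full F)) = real n * cond_entropy F (past F)"
    and "real n * cond_entropy F (past F) \<le> family_entropy (block n F)"
proof -
  show eq: "cond_entropy (block n F) (pre n (full F)) = real n * cond_entropy F (past F)"
    using cond_entropy_block[of F "{}" n] F by simp
  show "real n * cond_entropy F (past F) \<le> family_entropy (block n F)"
    using cond_entropy_le[of "block n F" "pre n (full F)" "{}"] F
    by (simp add: eq finite_block block_subset_sets pre_subset_sets full_subset_sets)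
qed

text \<open>If all these conditional entropies were at most \<open>c\<close>, then by \<open>cond_entropy_block\<close> so would be
  the average over time of the entropy of \<open>R\<close> given the far future of \<open>W = R \<union> Q\<close>, and the entropy
  rate of \<open>W\<close> would fall short of itself by at least \<open>h(R) - c\<close>.\<close>
lemma cond_entropy_past_tail:
  assumes R: "finite R" "R \<subseteq> sets M" and Q: "finite Q" "Q \<subseteq> sets M"
    and c: "c < cond_entropy R (past R)"
  shows "\<exists>k. c < cond_entropy R (past R \<union> pre k (full Q))"
proof (rule ccontr)
  assume "\<not> ?thesis"
  then have le: "cond_entropy R (past R \<union> pre k (full Q)) \<le> c" for k
    by (simp add: not_less)
  define W where "W = R \<union> Q"
  have W: "finite W" "W \<subseteq> sets M"
    using R Q by (auto simp: W_def)
  let ?h = "\<lambda>F. cond_entropy F (past F)"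
  \<comment> \<open>The entropy of \<open>block n W\<close> given its far future is \<open>n\<close>
    times the rate of \<open>W\<close>. The chain rule splits it into a part for \<open>R\<close>,
    at most \<open>n * c\<close>, and a part for \<open>Q\<close>, at most the entropy of
    \<open>block n W\<close> minus that of \<open>block n R\<close>; the latter is at least
    \<open>n\<close> times the rate of \<open>R\<close>.\<close>
  have "real n * ?h W \<le> real n * c + family_entropy (block n W) - real n * ?h R" for n
  proof -
    let ?Z = "pre n (full W)"
    have Z: "?Z \<subseteq> sets M"
      using W by (simp add: pre_subset_sets full_subset_sets)
    note blk = R Q finite_block block_subset_sets
    have "real n * ?h W = cond_entropy (block n R \<union> block n Q) ?Z"
      using family_entropy_block_ge(1)[OF W] by (simp add: W_def block_Un)
    also have "\<dots> = cond_entropy (block n R) ?Z + cond_entropy (block n Q) (block n R \<union> ?Z)"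
      using Z by (intro cond_entropy_Un blk)
    also have "cond_entropy (block n R) ?Z \<le> real n * c"
      unfolding W_def cond_entropy_block[OF R Q(2)]
      using sum_mono[of "{..<n}" _ "\<lambda>_. c"] le by simp
    also have "cond_entropy (block n Q) (block n R \<union> ?Z)
        \<le> family_entropy (block n Q \<union> block n R) - family_entropy (block n R)"
      using Z blk by (intro cond_entropy_le) auto
    finally show ?thesis
      using family_entropy_block_ge(2)[OF R, of n] by (simp add: W_def block_Un Un_commute)
  qed
  then have "?h W + (?h R - c) \<le> family_entropy (block n W) / real n" if "n \<ge> 1" for n
    using that by (simp add: field_simps)
  then have "?h W + (?h R - c) \<le> ?h W"
    by (intro LIMSEQ_le_const[OF block_entropy_limit[OF W]]) blast
  then show False using c by simp
qed

text \<open>By the chain rule \<open>A\<close> loses no more entropy than \<open>R\<close> does,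
  since the remaining term, the entropy of \<open>R\<close> given \<open>A\<close> and the
  conditions, can only fall as well. The inductive construction enlarges \<open>R\<close> while
  tracking the entropy of a fixed subfamily.\<close>

lemma cond_entropy_past_tail_subset:
  assumes R: "finite R" "R \<subseteq> sets M" and Q: "finite Q" "Q \<subseteq> sets M" and A: "A \<subseteq> R"
    and c: "c < cond_entropy A (past R)"
  shows "\<exists>k. c < cond_entropy A (past R \<union> pre k (full Q))"
proof -
  have chain: "cond_entropy R G = cond_entropy A G + cond_entropy R (A \<union> G)"
    if "G \<subseteq> sets M" for G
    using cond_entropy_Un[of A R G] that R A
    by (metis Un_absorb1 finite_subset subset_trans)
  have sub: "past R \<subseteq> sets M" "past R \<union> pre k (full Q) \<subseteq> sets M" for k
    using R Q by (auto simp: past_subset_sets pre_subset_sets full_subset_sets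
        intro: subsetD[OF pre_subset_sets] subsetD[OF past_subset_sets] full_subset_sets)
  have "c + cond_entropy R (A \<union> past R) < cond_entropy R (past R)"
    using c chain[OF sub(1)] by simp
  then obtain k where k: "c + cond_entropy R (A \<union> past R)
      < cond_entropy R (past R \<union> pre k (full Q))"
    using cond_entropy_past_tail[OF R Q] by blast
  also have "\<dots> \<le> cond_entropy A (past R \<union> pre k (full Q)) + cond_entropy R (A \<union> past R)"
    unfolding chain[OF sub(2)]
    using R A sub by (intro add_left_mono cond_entropy_antimono) auto
  finally show ?thesis by auto
qed

text \<open>At each stage \<open>Q n\<close> joins the current finite family with a delay
  \<open>k\<close> chosen so late that the strict bound \<open>c <\<close> survives.
  \<open>G\<close> is the union of the pasts: in the union the bound persists as
  \<open>c \<le>\<close>, and \<open>G\<close> is countable because every stage is finite.\<close>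

lemma exists_tail_family:
  fixes Q :: "nat \<Rightarrow> 'a set set"
  assumes P: "finite P" "P \<subseteq> sets M" and c: "c < cond_entropy P (past P)"
    and Q: "\<And>n. finite (Q n)" "\<And>n. Q n \<subseteq> sets M"
  shows "\<exists>G. G \<subseteq> sets M \<and> countable G \<and> c \<le> cond_entropy P G
    \<and> (\<forall>n. \<exists>k. \<forall>i\<ge>k. pre i (Q n) \<subseteq> G)"
proof -
  let ?ok = "\<lambda>R. finite R \<and> R \<subseteq> sets M \<and> P \<subseteq> R \<and> c < cond_entropy P (past R)"
  have "\<exists>R. \<forall>n. ?ok (R n) \<and> (\<exists>k. R (Suc n) = R n \<union> pre k (Q n))"
  proof (rule dependent_nat_choice)
    show "\<exists>R. ?ok R" using P c by blast
  next
    fix R n assume ok: "?ok R"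
    then obtain k where k: "c < cond_entropy P (past R \<union> pre k (full (Q n)))"
      using cond_entropy_past_tail_subset[of R "Q n" P c] Q by blast
    \<comment> \<open>The past of the delayed copy of \<open>Q n\<close> consists of its preimages
      at times after \<open>k\<close>, so the tail from \<open>k\<close> contains it.\<close>
    have "past (R \<union> pre k (Q n)) \<subseteq> past R \<union> pre k (full (Q n))"
    proof -
      have "pre (Suc i) (pre k (Q n)) = pre k (pre (Suc i) (Q n))" for i
        unfolding pre_pre by (simp only: add.commute)
      then have "past (R \<union> pre k (Q n)) = past R \<union> (\<Union>i. pre k (pre (Suc i) (Q n)))"
        by (simp add: past_def pre_Un UN_Un_distrib)
      moreover have "(\<Union>i. pre k (pre (Suc i) (Q n))) \<subseteq> pre k (full (Q n))"
        unfolding full_def pre_UN by blast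
      ultimately show ?thesis by blast
    qed
    then have "c < cond_entropy P (past (R \<union> pre k (Q n)))"
      using P ok Q k
      by (meson cond_entropy_antimono Un_least past_subset_sets pre_subset_sets full_subset_sets
          less_le_trans)
    then have "?ok (R \<union> pre k (Q n))"
      using ok Q[of n] finite_pre[OF Q(1)] pre_subset_sets[OF Q(2)]
      by (simp add: le_supI1)
    then show "\<exists>R'. ?ok R' \<and> (\<exists>k. R' = R \<union> pre k (Q n))" by blast
  qed
  then obtain R where ok: "\<And>n. ?ok (R n)" and step: "\<And>n. \<exists>k. R (Suc n) = R n \<union> pre k (Q n)"
    by blast
  define G where "G = (\<Union>n. past (R n))"
  show ?thesis
  proof (intro exI[of _ G] conjI allI)
    show "G \<subseteq> sets M"
      unfolding G_def using ok by (intro UN_least past_subset_sets) blast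
    show "countable G"
      unfolding G_def past_def
      using ok by (intro countable_UN countableI_type countable_finite finite_pre) blast
    have "incseq R"
      using step by (metis incseq_SucI Un_upper1)
    then have "incseq (\<lambda>n. past (R n))"
      unfolding incseq_def past_def pre_def by (meson UN_mono image_mono order_refl)
    then show "c \<le> cond_entropy P G"
      unfolding G_def using P ok past_subset_sets
      by (intro cond_entropy_incseq_Union) (auto intro: less_imp_le)
    fix n
    obtain k where k: "R (Suc n) = R n \<union> pre k (Q n)"
      using step by blast
    \<comment> \<open>The bound is \<open>Suc k\<close> because the past of
      \<open>pre k (Q n)\<close> begins one time step after \<open>k\<close>.\<close>
    have "pre i (Q n) \<subseteq> G" if "i \<ge> Suc k" for i
    proof -
      have "pre i (Q n) = pre (Suc (i - Suc k)) (pre k (Q n))"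
        using that by (simp add: pre_pre)
      also have "\<dots> \<subseteq> past (R (Suc n))"
        unfolding past_def k pre_Un by blast
      finally show ?thesis by (auto simp: G_def)
    qed
    then show "\<exists>k. \<forall>i\<ge>k. pre i (Q n) \<subseteq> G" by blast
  qed
qed

end

section \<open>Partitions as families of events\<close>

text \<open>Exactly one block of each partition contains a given point \<open>x\<close>. The blocks
  through \<open>x\<close> decide membership in all other blocks, so their intersection is the cell
  of \<open>x\<close>.\<close>

lemma common_refinement_eq_cells:
  assumes part: "\<And>P. P \<in> PP \<Longrightarrow> partition_on UNIV P"
  shows "common_refinement PP = range (cell (\<Union>PP)) - {{}}"
proof -
  have cell_eq: "\<Inter> (f ` PP) = cell (\<Union>PP) {E \<in> \<Union>PP. x \<in> E}"
    if f: "\<And>P. P \<in> PP \<Longrightarrow> f P \<in> P \<and> x \<in> f P" for f x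
  proof -
    have block: "x \<in> E \<longleftrightarrow> E = f P" if "P \<in> PP" "E \<in> P" for P E
      using part[OF that(1)] f[OF that(1)] that(2)
      by (auto simp: partition_on_def disjoint_def)
    have block': "y \<in> E \<longleftrightarrow> E = f P" if "P \<in> PP" "E \<in> P" "y \<in> f P" for y P E
      using part[OF that(1)] f[OF that(1)] that(2,3)
      by (auto simp: partition_on_def disjoint_def)
    show ?thesis
    proof (intro set_eqI iffI)
      fix y assume y: "y \<in> \<Inter> (f ` PP)"
      have "y \<in> E \<longleftrightarrow> x \<in> E" if "P \<in> PP" "E \<in> P" for P E
        using block[OF that] block'[OF that, of y] y that by blast
      then show "y \<in> cell (\<Union>PP) {E \<in> \<Union>PP. x \<in> E}"
        by (auto simp: cell_def)
    next
      fix y assume "y \<in> cell (\<Union>PP) {E \<in> \<Union>PP. x \<in> E}"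
      then have "{E \<in> \<Union>PP. y \<in> E} = {E \<in> \<Union>PP. x \<in> E}"
        by (simp add: cell_def)
      then have "y \<in> f P" if "P \<in> PP" for P
        using f[OF that] that by blast
      then show "y \<in> \<Inter> (f ` PP)" by blast
    qed
  qed
  show ?thesis
  proof (intro set_eqI iffI)
    fix X assume X: "X \<in> common_refinement PP"
    then obtain f where f: "f \<in> (\<Pi> P\<in>PP. P)" "X = \<Inter> (f ` PP)" "X \<noteq> {}"
      by (auto simp: common_refinement)
    then obtain x where "x \<in> X" by blast
    then show "X \<in> range (cell (\<Union>PP)) - {{}}"
      using cell_eq[of f x] f by blast
  next
    fix X assume "X \<in> range (cell (\<Union>PP)) - {{}}"
    then obtain S x where X: "X = cell (\<Union>PP) S" "x \<in> X" by blast
    have "\<exists>E\<in>P. x \<in> E" if "P \<in> PP" for P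
      using part[OF that] by (metis UNIV_I UnionE partition_onD1)
    then obtain f where f: "\<And>P. P \<in> PP \<Longrightarrow> f P \<in> P \<and> x \<in> f P"
      by metis
    have "X = \<Inter> (f ` PP)"
      using cell_eq[OF f] X by (simp add: cell_def)
    moreover have "\<Inter> (f ` PP) \<in> (\<Union>f \<in> (\<Pi> P\<in>PP. P). {\<Inter> (f ` PP)})"
      using f by blast
    ultimately show "X \<in> common_refinement PP"
      unfolding common_refinement using X(2) by blast
  qed
qed

context prob_space_UNIV
begin

lemma partition_entropy_common_refinement:
  assumes "\<And>P. P \<in> PP \<Longrightarrow> partition_on UNIV P" "finite (\<Union>PP)"
  shows "partition_entropy M (common_refinement PP) = family_entropy (\<Union>PP)"
proof -
  let ?F = "\<Union>PP"
  let ?I = "{S \<in> Pow ?F. cell ?F S \<noteq> {}}"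
  have "inj_on (cell ?F) ?I"
  proof (rule inj_onI)
    fix S S' assume "S \<in> ?I" "S' \<in> ?I" "cell ?F S = cell ?F S'"
    then obtain x where "x \<in> cell ?F S" "x \<in> cell ?F S'" by blast
    then show "S = S'" by (simp add: cell_def)
  qed
  moreover have "common_refinement PP = cell ?F ` ?I"
  proof -
    have "S \<subseteq> ?F" if "cell ?F S \<noteq> {}" for S
      using that by (auto simp: cell_def)
    then have "range (cell ?F) - {{}} = cell ?F ` ?I" by blast
    then show ?thesis
      using common_refinement_eq_cells[OF assms(1)] by simp
  qed
  ultimately have "partition_entropy M (common_refinement PP) = (\<Sum>S\<in>?I. eta (prob (cell ?F S)))"
    by (simp add: partition_entropy_def eta_def sum.reindex sum_negf)
  also have "\<dots> = family_entropy ?F"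
    unfolding family_entropy_def using assms(2) by (intro sum.mono_neutral_left) auto
  finally show ?thesis .
qed

section \<open>Conditional entropy of a single event\<close>

text \<open>Conditional entropy is subadditive over the members of \<open>A\<close>, by the chain
  rule and antimonotonicity. This replaces the partition by one event and its complement.\<close>

lemma cond_entropy_pos_single:
  assumes A: "finite A" "A \<subseteq> sets M" and G: "G \<subseteq> sets M" and "0 < cond_entropy A G"
  obtains E where "E \<in> A" "0 < cond_entropy {E} G"
proof -
  have "cond_entropy A G \<le> (\<Sum>E\<in>A. cond_entropy {E} G)"
    using A
  proof (induction A rule: finite_induct)
    case (insert E A)
    have "cond_entropy (insert E A) G = cond_entropy {E} G + cond_entropy A ({E} \<union> G)"
      using cond_entropy_Un[of "{E}" A G] insert G by simp
    also have "cond_entropy A ({E} \<union> G) \<le> cond_entropy A G"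
      using insert G by (intro cond_entropy_antimono) auto
    finally show ?case using insert by simp
  qed simp
  then have "\<not> (\<forall>E\<in>A. cond_entropy {E} G \<le> 0)"
    using assms(4) sum_nonpos[of A "\<lambda>E. cond_entropy {E} G"] by force
  then show thesis using that by force
qed

text \<open>The assumption \<open>det\<close> makes \<open>E\<close> a union of cells of
  \<open>F\<close>, so \<open>E\<close> cuts no cell into two nonempty pieces.\<close>

lemma family_entropy_insert_determined:
  assumes F: "finite F" "F \<subseteq> sets M" and E: "E \<in> sets M"
    and det: "\<And>x y. x \<in> E \<Longrightarrow> (\<And>D. D \<in> F \<Longrightarrow> x \<in> D \<longleftrightarrow> y \<in> D) \<Longrightarrow> y \<in> E"
  shows "family_entropy (insert E F) = family_entropy F"
proof (cases "E \<in> F")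
  case False
  have "split_gain (prob (cell F S \<inter> E)) (prob (cell F S - E)) = 0" for S
  proof -
    have "cell F S \<inter> E = {} \<or> cell F S - E = {}"
    proof (rule ccontr)
      assume "\<not> ?thesis"
      then obtain x y where xy: "x \<in> cell F S" "x \<in> E" "y \<in> cell F S" "y \<notin> E" by blast
      then have "{D \<in> F. x \<in> D} = {D \<in> F. y \<in> D}"
        by (simp add: cell_def)
      then show False using det[of x y] xy by blast
    qed
    then have "prob (cell F S \<inter> E) = 0 \<or> prob (cell F S - E) = 0"
      by (metis measure_empty)
    then show ?thesis by (auto simp: split_gain_def)
  qed
  then show ?thesis
    using family_entropy_insert[OF F E False] by simp
qed (simp add: insert_absorb)

text \<open>\<open>E'\<close> is a union of cells of \<open>F\<close>, so conditioning on
  \<open>F\<close> is the same as conditioning on \<open>F\<close> and \<open>E'\<close> together;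
  dropping \<open>F\<close> then only increases the entropy.\<close>

lemma cond_entropy_le_approximant:
  assumes E: "E \<in> sets M" and G: "G \<subseteq> sets M" and F: "finite F" "F \<subseteq> G" and E': "E' \<in> sets M"
    and det: "\<And>x y. x \<in> E' \<Longrightarrow> (\<And>D. D \<in> F \<Longrightarrow> x \<in> D \<longleftrightarrow> y \<in> D) \<Longrightarrow> y \<in> E'"
  shows "cond_entropy {E} G \<le> family_entropy {E, E'} - family_entropy {E'}"
proof -
  have F': "F \<subseteq> sets M" using F G by blast
  have "cond_entropy {E} G \<le> family_entropy ({E} \<union> F) - family_entropy F"
    using E G F by (intro cond_entropy_le) auto
  also have "\<dots> \<le> family_entropy ({E} \<union> insert E' F) - family_entropy (insert E' F)"
  proof -
    have "family_entropy (insert E' F) = family_entropy F"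
      by (rule family_entropy_insert_determined[OF F(1) F' E']) (fact det)
    moreover have "family_entropy ({E} \<union> F) \<le> family_entropy ({E} \<union> insert E' F)"
      using E E' F F' by (intro family_entropy_mono) auto
    ultimately show ?thesis by simp
  qed
  also have "\<dots> \<le> family_entropy ({E} \<union> {E'}) - family_entropy {E'}"
    using E E' F F' by (intro family_entropy_antimono_diff) auto
  finally show ?thesis by (simp add: insert_commute)
qed

text \<open>The entropy of \<open>E\<close> given \<open>D n\<close> is a sum of two split gains,
  one inside \<open>D n\<close> and one outside. In each of them one of the two pieces lies in the
  symmetric difference and vanishes in the limit, and \<open>eta\<close> is continuous.\<close>

lemma family_entropy_pair_tendsto_0:
  fixes D :: "nat \<Rightarrow> 'a set"
  assumes E: "E \<in> sets M" and D: "\<And>n. D n \<in> sets M"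
    and lim: "(\<lambda>n. prob ((E - D n) \<union> (D n - E))) \<longlonglongrightarrow> 0"
  shows "(\<lambda>n. family_entropy {E, D n} - family_entropy {D n}) \<longlonglongrightarrow> 0"
proof -
  let ?g = "\<lambda>n. split_gain (prob (E \<inter> D n)) (prob (D n - E))
    + split_gain (prob (E - D n)) (prob (UNIV - D n - E))"
  have UNIV_sets: "UNIV \<in> sets M"
    using sets.top[of M] by simp
  have small: "(\<lambda>n. prob (B n)) \<longlonglongrightarrow> 0"
    if "\<And>n. B n \<subseteq> (E - D n) \<union> (D n - E)" for B :: "nat \<Rightarrow> 'a set"
    using lim
  proof (rule tendsto_sandwich[rotated 3])
    show "\<forall>\<^sub>F n in sequentially. prob (B n) \<le> prob ((E - D n) \<union> (D n - E))"
      using that E D by (intro always_eventually allI finite_measure_mono) auto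
  qed auto
  have out: "(\<lambda>n. prob (D n - E)) \<longlonglongrightarrow> 0" and inn: "(\<lambda>n. prob (E - D n)) \<longlonglongrightarrow> 0"
    by (auto intro!: small)
  have "prob (E \<inter> D n) = prob E - prob (E - D n)" for n
    using finite_measure_Diff'[OF E D[of n]] by simp
  then have int: "(\<lambda>n. prob (E \<inter> D n)) \<longlonglongrightarrow> prob E"
    using tendsto_diff[OF tendsto_const inn, of "prob E"] by simp
  have "prob (UNIV - D n - E) = prob (UNIV - E) - prob (D n - E)" for n
  proof -
    have "UNIV - D n - E = (UNIV - E) - (D n - E)" by blast
    then show ?thesis
      using E D UNIV_sets by (metis Diff_mono finite_measure_Diff order_refl sets.Diff subset_UNIV)
  qed
  then have ext: "(\<lambda>n. prob (UNIV - D n - E)) \<longlonglongrightarrow> prob (UNIV - E)"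
    using tendsto_diff[OF tendsto_const out, of "prob (UNIV - E)"] by simp
  have "?g \<longlonglongrightarrow> (eta (prob E) + eta 0 - eta (prob E + 0))
    + (eta 0 + eta (prob (UNIV - E)) - eta (0 + prob (UNIV - E)))"
    unfolding split_gain_def
    by (intro tendsto_intros tendsto_eta out inn int ext) auto
  then have lim_g: "?g \<longlonglongrightarrow> 0" by simp
  have nonneg: "0 \<le> ?g n" for n
    by (intro add_nonneg_nonneg split_gain_nonneg) auto
  \<comment> \<open>If \<open>E = D n\<close>, the two-element family collapses to a singleton and
    the insertion formula does not apply, but the difference is 0.\<close>
  have "\<bar>family_entropy {E, D n} - family_entropy {D n}\<bar> \<le> ?g n" for n
  proof (cases "E = D n")
    case True
    then show ?thesis using nonneg[of n] by simp
  next
    case False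
    have "cell {D n} {} = UNIV - D n" "cell {D n} {D n} = D n"
      by (auto simp: cell_def)
    moreover have "D n \<inter> E = E \<inter> D n" "(UNIV - D n) \<inter> E = E - D n" by auto
    moreover have "Pow {D n} = {{}, {D n}}" by blast
    ultimately have "family_entropy {E, D n} - family_entropy {D n} = ?g n"
      using family_entropy_insert[of "{D n}" E] E D False
      by simp
    then show ?thesis using nonneg[of n] by simp
  qed
  then show ?thesis
    by (intro Lim_null_comparison[OF _ lim_g]) auto
qed

end

section \<open>Kolmogorov-Sinai entropy as conditional entropy\<close>

context surj_mpt
begin

lemma empty_notin_pre:
  assumes "{} \<notin> P"
  shows "{} \<notin> pre k P"
  using assms inj_vimage_funpow[of k] by (auto simp: pre_def dest: injD[where y = "{}"])

lemma iterated_partition_eq: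
  assumes "finite_measurable_partition M P"
  shows "iterated_partition M T P n = common_refinement ((\<lambda>i. pre i P) ` {..<n})"
proof -
  have "{} \<notin> P"
    using assms by (simp add: finite_measurable_partition_def partition_on_def)
  then have "{} \<notin> pre i P" for i
    by (rule empty_notin_pre)
  then show ?thesis
    by (simp add: iterated_partition_def preimage_partition_def pre_def)
qed

lemma partition_on_pre:
  assumes "partition_on UNIV P"
  shows "partition_on UNIV (pre k P)"
proof (rule partition_onI)
  show "\<Union> (pre k P) = UNIV"
    using partition_onD1[OF assms] by (metis pre_def vimage_UNIV vimage_Union)
  show "{} \<notin> pre k P"
    using assms by (intro empty_notin_pre) (simp add: partition_on_def)
  show "disjnt X Y" if XY: "X \<in> pre k P" "Y \<in> pre k P" "X \<noteq> Y" for X Y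
  proof -
    obtain A B where AB: "A \<in> P" "B \<in> P" "X = (T ^^ k) -` A" "Y = (T ^^ k) -` B"
      using XY by (auto simp: pre_def)
    then have "A \<noteq> B"
      using XY(3) by blast
    then have "A \<inter> B = {}"
      using AB assms by (metis disjnt_def partition_on_def disjointD)
    then show ?thesis
      using AB by (auto simp: disjnt_def)
  qed
qed

text \<open>\<open>block_entropy_limit\<close> provides convergence, so the \<open>lim\<close> in
  \<open>entropy_wrt\<close> denotes a genuine limit.\<close>

lemma entropy_wrt_eq:
  assumes P: "finite_measurable_partition M P"
  shows "entropy_wrt M T P = cond_entropy P (past P)"
proof -
  have P': "finite P" "P \<subseteq> sets M" "partition_on UNIV P"
    using P by (auto simp: finite_measurable_partition_def)
  have "partition_entropy M (iterated_partition M T P n) = family_entropy (block n P)" for n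
    unfolding iterated_partition_eq[OF P] block_def
    using P' by (subst partition_entropy_common_refinement) (auto simp: partition_on_pre finite_pre)
  then show ?thesis
    using block_entropy_limit[OF P'(1,2)] by (simp add: entropy_wrt_def limI)
qed

end

section \<open>Closed approximation of Borel sets\<close>

lemma LIMSEQ_gap:
  fixes l :: real
  assumes "f \<longlonglongrightarrow> l" "0 < e"
  obtains n where "l - f n < e"
proof -
  obtain n where "norm (f n - l) < e"
    using LIMSEQ_D[OF assms] by blast
  then have "l - f n < e" by (simp add: abs_less_iff)
  then show thesis by (rule that)
qed

text \<open>Induction over the generation of the Borel sets from open sets. Approximating a set and
  its complement at once makes the complement step an exchange of \<open>C\<close> and
  \<open>D\<close>.\<close>

lemma borel_closed_approx:
  fixes M :: "'a::metric_space measure"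
  assumes "prob_space M" and sets: "sets M = sets borel" and "E \<in> sets borel" and "0 < e"
  shows "\<exists>C D. closed C \<and> closed D \<and> C \<subseteq> E \<and> D \<subseteq> - E \<and> measure M (UNIV - (C \<union> D)) < e"
proof -
  interpret prob_space M by fact
  have space: "space M = UNIV"
    using sets_eq_imp_space_eq[OF sets] by simp
  have closed_sets [measurable]: "closed C \<Longrightarrow> C \<in> sets M" for C
    by (simp add: sets)
  have UNIV_sets [measurable]: "UNIV \<in> sets M"
    by (simp add: sets)
  have "E \<in> sigma_sets UNIV {S. open S}"
    using assms by (simp add: sets_borel)
  then show ?thesis
    using \<open>0 < e\<close>
  proof (induction E arbitrary: e rule: sigma_sets.induct)
    case (Basic E)
    then have "open E" by simp
    \<comment> \<open>The points at distance at least \<open>1 / (n + 1)\<close> from every point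
      outside \<open>E\<close>.\<close>
    define C where "C n = - (\<Union>y\<in>-E. ball y (inverse (real (Suc n))))" for n
    have closed: "closed (C n)" for n
      unfolding C_def by (auto intro!: closed_Compl)
    have "incseq C"
    proof (rule incseq_SucI)
      fix n
      have "inverse (real (Suc (Suc n))) \<le> inverse (real (Suc n))"
        by (simp add: field_simps)
      then show "C n \<le> C (Suc n)"
        unfolding C_def by (meson Compl_anti_mono UN_mono order_refl subset_ball)
    qed
    moreover have "(\<Union>n. C n) = E"
    proof (intro equalityI subsetI)
      fix x assume "x \<in> E"
      then obtain r where r: "0 < r" "ball x r \<subseteq> E"
        using \<open>open E\<close> open_contains_ball by blast
      obtain n where "inverse (real (Suc n)) < r"
        using reals_Archimedean r(1) by blast
      then have "x \<in> C n"
        using r(2) by (force simp: C_def dist_commute)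
      then show "x \<in> (\<Union>n. C n)" by blast
    next
      fix x assume "x \<in> (\<Union>n. C n)"
      then show "x \<in> E" by (force simp: C_def)
    qed
    ultimately have "(\<lambda>n. prob (C n)) \<longlonglongrightarrow> prob E"
      using finite_Lim_measure_incseq[of C] closed_sets[OF closed] by (simp add: image_subset_iff)
    then obtain n where n: "prob E - prob (C n) < e"
      using Basic(2) by (rule LIMSEQ_gap)
    have sub: "C n \<subseteq> E"
      using \<open>(\<Union>n. C n) = E\<close> by blast
    have "prob (UNIV - (C n \<union> - E)) = prob (E - C n)"
      by (rule arg_cong[of _ _ prob]) auto
    also have "\<dots> < e"
      using n sub closed \<open>open E\<close> by (subst finite_measure_Diff) (auto simp: sets)
    finally show ?case
      using closed[of n] sub \<open>open E\<close> by (intro exI[of _ "C n"] exI[of _ "- E"]) auto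
  next
    case Empty
    then show ?case by (intro exI[of _ "{}"] exI[of _ UNIV]) auto
  next
    case (Compl E)
    obtain C D where "closed C" "closed D" "C \<subseteq> E" "D \<subseteq> - E" "measure M (UNIV - (C \<union> D)) < e"
      using Compl.IH[OF Compl.prems] by (elim exE conjE)
    then show ?case
      by (intro exI[of _ D] exI[of _ C]) (auto simp: Un_commute)
  next
    case (Union E)
    \<comment> \<open>Half of \<open>e\<close> is spread over the sets \<open>E n\<close> as a
      geometric series. The other half pays for cutting the union of the \<open>C n\<close>, which
      need not be closed, to a finite one.\<close>
    have "\<exists>C D. closed C \<and> closed D \<and> C \<subseteq> E n \<and> D \<subseteq> - E n
      \<and> prob (UNIV - (C \<union> D)) < e / 2 * (1 / 2) ^ Suc n" for n
      using Union.IH[of "e / 2 * (1 / 2) ^ Suc n" n] Union.prems by simp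
    then obtain C D where CD: "\<And>n. closed (C n)" "\<And>n. closed (D n)" "\<And>n. C n \<subseteq> E n"
      "\<And>n. D n \<subseteq> - E n" "\<And>n. prob (UNIV - (C n \<union> D n)) < e / 2 * (1 / 2) ^ Suc n"
      by metis
    have [measurable]: "C n \<in> sets M" "D n \<in> sets M" for n
      using CD by (auto simp: sets)
    define C' where "C' n = (\<Union>i\<le>n. C i)" for n
    have closed': "closed (C' n)" for n
      unfolding C'_def using CD by auto
    have "incseq C'"
      unfolding C'_def by (force intro!: incseq_SucI)
    have Union': "(\<Union>n. C' n) = (\<Union>n. C n)"
      unfolding C'_def by blast
    have "(\<lambda>n. prob (C' n)) \<longlonglongrightarrow> prob (\<Union>n. C n)"
      using finite_Lim_measure_incseq[OF _ \<open>incseq C'\<close>] closed_sets[OF closed'] Union'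
      by (simp add: image_subset_iff)
    then obtain N where N: "prob (\<Union>n. C n) - prob (C' N) < e / 2"
      using Union.prems by (rule LIMSEQ_gap[OF _ half_gt_zero])
    have [measurable]: "C' N \<in> sets M"
      using closed' by (auto simp: sets)
    have sum: "(\<lambda>n. e / 2 * (1 / 2) ^ Suc n) sums (e / 2 * 1)"
      by (intro sums_mult power_half_series)
    have summable: "summable (\<lambda>n. prob (UNIV - (C n \<union> D n)))"
      using CD(5) by (intro summable_comparison_test[OF _ sums_summable[OF sum]])
        (auto intro!: less_imp_le)
    have "UNIV - (C' N \<union> (\<Inter>n. D n)) \<subseteq> (\<Union>n. UNIV - (C n \<union> D n)) \<union> ((\<Union>n. C n) - C' N)"
      by blast
    then have "prob (UNIV - (C' N \<union> (\<Inter>n. D n)))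
        \<le> prob ((\<Union>n. UNIV - (C n \<union> D n)) \<union> ((\<Union>n. C n) - C' N))"
      by (intro finite_measure_mono) measurable
    also have "\<dots> \<le> prob (\<Union>n. UNIV - (C n \<union> D n)) + prob ((\<Union>n. C n) - C' N)"
      by (intro measure_Un_le) measurable
    also have "prob (\<Union>n. UNIV - (C n \<union> D n)) \<le> (\<Sum>n. prob (UNIV - (C n \<union> D n)))"
      using summable by (intro finite_measure_subadditive_countably) auto
    also have "\<dots> \<le> (\<Sum>n. e / 2 * (1 / 2) ^ Suc n)"
      using CD(5) by (intro suminf_le summable sums_summable[OF sum]) (auto intro: less_imp_le)
    also have "\<dots> = e / 2"
      using sums_unique[OF sum] by simp
    also have "prob ((\<Union>n. C n) - C' N) = prob (\<Union>n. C n) - prob (C' N)"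
      using Union' by (intro finite_measure_Diff) auto
    finally have "prob (UNIV - (C' N \<union> (\<Inter>n. D n))) < e"
      using N by simp
    moreover have "C' N \<subseteq> (\<Union>n. E n)" "(\<Inter>n. D n) \<subseteq> - (\<Union>n. E n)"
      using CD(3,4) unfolding C'_def by blast+
    ultimately show ?case
      using closed' CD(2) by (intro exI[of _ "C' N"] exI[of _ "\<Inter>n. D n"]) auto
  qed
qed

text \<open>On the intersection of the sets \<open>C B \<union> D B\<close>, which is closed and has
  almost full measure, every \<open>B\<close> in \<open>H\<close> is relatively closed and so is its
  complement.\<close>

lemma borel_closed_approx_countable:
  fixes M :: "'a::metric_space measure"
  assumes "prob_space M" and sets: "sets M = sets borel"
    and H: "countable H" "H \<subseteq> sets M" and "0 < e"
  shows "\<exists>C D. (\<forall>B\<in>H. closed (C B) \<and> closed (D B) \<and> C B \<subseteq> B \<and> D B \<subseteq> - B)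
    \<and> measure M (UNIV - (\<Inter>B\<in>H. C B \<union> D B)) \<le> e"
proof -
  interpret prob_space M by fact
  define n where "n = to_nat_on H"
  have "\<forall>B\<in>H. \<exists>C D. closed C \<and> closed D \<and> C \<subseteq> B \<and> D \<subseteq> - B
      \<and> prob (UNIV - (C \<union> D)) < e * (1 / 2) ^ Suc (n B)"
    using H \<open>0 < e\<close> by (intro ballI borel_closed_approx[OF \<open>prob_space M\<close> sets]) (auto simp: sets)
  then obtain C D where CD: "\<And>B. B \<in> H \<Longrightarrow> closed (C B) \<and> closed (D B) \<and> C B \<subseteq> B \<and> D B \<subseteq> - B"
    and less: "\<And>B. B \<in> H \<Longrightarrow> prob (UNIV - (C B \<union> D B)) < e * (1 / 2) ^ Suc (n B)"
    by metis
  define X where "X i = (if i \<in> n ` H then UNIV - (C (from_nat_into H i) \<union> D (from_nat_into H i)) else {})" for i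
  have X_n: "X (n B) = UNIV - (C B \<union> D B)" if "B \<in> H" for B
    using that H by (auto simp: X_def n_def)
  have X_sets: "X i \<in> sets M" for i
  proof (cases "i \<in> n ` H")
    case True
    then obtain B where "B \<in> H" "i = n B" by blast
    then show ?thesis using CD[of B] X_n by (auto simp: sets)
  next
    case False
    then show ?thesis by (simp add: X_def)
  qed
  have X_le: "prob (X i) \<le> e * (1 / 2) ^ Suc i" for i
  proof (cases "i \<in> n ` H")
    case True
    then obtain B where "B \<in> H" "i = n B" by blast
    then show ?thesis using less[of B] X_n by (auto intro: less_imp_le)
  next
    case False
    then show ?thesis using \<open>0 < e\<close> by (simp add: X_def)
  qed
  have sum: "(\<lambda>i. e * (1 / 2) ^ Suc i) sums (e * 1)"
    by (intro sums_mult power_half_series)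
  have summable: "summable (\<lambda>i. prob (X i))"
    using X_le by (intro summable_comparison_test[OF _ sums_summable[OF sum]]) auto
  have "UNIV - (\<Inter>B\<in>H. C B \<union> D B) \<subseteq> (\<Union>i. X i)"
    using X_n by blast
  then have "prob (UNIV - (\<Inter>B\<in>H. C B \<union> D B)) \<le> prob (\<Union>i. X i)"
    using X_sets by (intro finite_measure_mono) auto
  also have "\<dots> \<le> (\<Sum>i. prob (X i))"
    using X_sets summable by (intro finite_measure_subadditive_countably) auto
  also have "\<dots> \<le> (\<Sum>i. e * (1 / 2) ^ Suc i)"
    by (intro suminf_le X_le summable sums_summable[OF sum])
  also have "\<dots> = e"
    using sums_unique[OF sum] by simp
  finally show ?thesis
    using CD by (intro exI[of _ C] exI[of _ D] conjI[OF ballI])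
qed

section \<open>Pairs of points that a countable family does not separate\<close>

text \<open>If every closed set of such points were null, \<open>E\<close> could be approximated in
  measure by sets \<open>E'\<close> that depend on finitely many members of \<open>G\<close>. Then
  \<open>cond_entropy_le_approximant\<close> and \<open>family_entropy_pair_tendsto_0\<close> would
  force the conditional entropy of \<open>E\<close> to be at most 0.\<close>

lemma exists_indistinguishable_pairs:
  fixes M :: "'a::metric_space measure"
  assumes compact: "compact (UNIV :: 'a set)"
    and "prob_space_UNIV M" and sets: "sets M = sets borel"
    and E: "E \<in> sets M" and G: "countable G" "G \<subseteq> sets M"
    and pos: "0 < prob_space_UNIV.cond_entropy M {E} G"
  shows "\<exists>A. closed A \<and> 0 < measure M A \<and> (\<forall>x\<in>A. \<exists>y. x \<noteq> y \<and> (\<forall>D\<in>G. x \<in> D \<longleftrightarrow> y \<in> D))"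
proof (rule ccontr)
  interpret prob_space_UNIV M by fact
  assume "\<not> ?thesis"
  then have null: "prob A = 0"
    if "closed A" "\<And>x. x \<in> A \<Longrightarrow> \<exists>y. x \<noteq> y \<and> (\<forall>D\<in>G. x \<in> D \<longleftrightarrow> y \<in> D)" for A
    using that by (metis measure_nonneg not_less order_antisym)
  have closed_sets: "closed C \<Longrightarrow> C \<in> sets M" for C
    by (simp add: sets)
  have "\<exists>E' F. E' \<in> sets M \<and> finite F \<and> F \<subseteq> G
      \<and> (\<forall>x y. x \<in> E' \<longrightarrow> (\<forall>D\<in>F. x \<in> D \<longleftrightarrow> y \<in> D) \<longrightarrow> y \<in> E')
      \<and> prob ((E - E') \<union> (E' - E)) \<le> d" if "0 < d" for d :: real
  proof -
    let ?H = "insert E G"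
    have H: "countable ?H" "?H \<subseteq> sets M" "0 < d / 2"
      using E G \<open>0 < d\<close> by auto
    obtain C D where CD': "\<forall>B\<in>?H. closed (C B) \<and> closed (D B) \<and> C B \<subseteq> B \<and> D B \<subseteq> - B"
      and K_le: "prob (UNIV - (\<Inter>B\<in>?H. C B \<union> D B)) \<le> d / 2"
      using borel_closed_approx_countable[OF prob_space_axioms sets H] by (elim exE conjE)
    note CD = bspec[OF CD']
    define K where "K = (\<Inter>B\<in>?H. C B \<union> D B)"
    have "closed K"
      unfolding K_def using CD by (intro closed_INT) auto
    have K_iff: "x \<in> B \<longleftrightarrow> x \<in> C B" "x \<notin> B \<longleftrightarrow> x \<in> D B" if "x \<in> K" "B \<in> ?H" for x B
      using that CD[OF that(2)] unfolding K_def by blast+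
    \<comment> \<open>Closed relations which on \<open>K \<times> K\<close> express that
      \<open>B\<close> does not separate two points, and that \<open>E\<close> does.\<close>
    define agree where "agree B = (C B \<times> C B) \<union> (D B \<times> D B)" for B
    define differ where "differ = (C E \<times> D E) \<union> (D E \<times> C E)"
    have closed_agree: "closed (agree B)" if "B \<in> ?H" for B
      unfolding agree_def using CD[OF that] by (intro closed_Un closed_Times) auto
    have "closed differ"
      unfolding differ_def using CD[of E] by (intro closed_Un closed_Times) auto
    have agree_iff: "(x, y) \<in> agree B \<longleftrightarrow> (x \<in> B \<longleftrightarrow> y \<in> B)" if "x \<in> K" "y \<in> K" "B \<in> ?H" for x y B
      using K_iff[OF that(1,3)] K_iff[OF that(2,3)] by (auto simp: agree_def)
    have differ_iff: "(x, y) \<in> differ \<longleftrightarrow> (x \<in> E \<longleftrightarrow> y \<notin> E)" if "x \<in> K" "y \<in> K" for x y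
      using K_iff[OF that(1), of E] K_iff[OF that(2), of E] by (auto simp: differ_def)
    have compact_UNIV2: "compact (UNIV :: ('a \<times> 'a) set)"
      using compact_Times[OF compact compact] by simp
    have compactI: "compact S" if "closed S" for S :: "('a \<times> 'a) set"
      using compact_Int_closed[OF compact_UNIV2 that] by simp

    \<comment> \<open>The points of \<open>K\<close> with a partner in \<open>K\<close> that
      \<open>E\<close> separates from them but no member of \<open>G\<close> does. As a projection
      of a compact set \<open>A\<close> is closed, and its points have partners as in
      \<open>null\<close>.\<close>
    define A where "A = fst ` ((K \<times> K) \<inter> differ \<inter> (\<Inter>B\<in>G. agree B))"
    have "closed ((K \<times> K) \<inter> differ \<inter> (\<Inter>B\<in>G. agree B))"
      using \<open>closed K\<close> \<open>closed differ\<close> closed_agree by (intro closed_Int closed_Times closed_INT) auto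
    then have "closed A"
      unfolding A_def
      by (intro compact_imp_closed[OF compact_continuous_image[OF continuous_on_fst[OF continuous_on_id] compactI]])
    moreover have "\<exists>y. x \<noteq> y \<and> (\<forall>D\<in>G. x \<in> D \<longleftrightarrow> y \<in> D)" if x: "x \<in> A" for x
    proof -
      obtain y where y: "x \<in> K" "y \<in> K" "(x, y) \<in> differ" "\<And>B. B \<in> G \<Longrightarrow> (x, y) \<in> agree B"
        using x by (auto simp: A_def)
      have "x \<noteq> y"
        using differ_iff[OF y(1,2)] y(3) by blast
      moreover have "x \<in> B \<longleftrightarrow> y \<in> B" if "B \<in> G" for B
        using agree_iff[OF y(1,2), of B] y(4)[OF that] that by simp
      ultimately show ?thesis by blast
    qed
    ultimately have "prob A = 0"
      by (rule null)
    \<comment> \<open>\<open>D'\<close> is a closed set that avoids the null set \<open>A\<close>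
      and misses measure less than \<open>d / 2\<close>; restricting \<open>K\<close> to it brings
      the total error to at most \<open>d\<close>.\<close>
    obtain C' D' where C'D': "closed C'" "closed D'" "C' \<subseteq> A" "D' \<subseteq> - A"
        "prob (UNIV - (C' \<union> D')) < d / 2"
      using borel_closed_approx[OF prob_space_axioms sets, of A "d / 2"] \<open>closed A\<close> \<open>0 < d\<close> by auto
    define K' where "K' = K \<inter> D'"
    have "closed K'"
      unfolding K'_def using \<open>closed K\<close> C'D' by auto
    have K'_le: "prob (UNIV - K') \<le> d"
    proof -
      have UNIV_sets: "UNIV \<in> sets M"
        using sets.top[of M] by simp
      note meas = closed_sets[OF \<open>closed K\<close>] closed_sets[OF \<open>closed A\<close>] closed_sets[OF C'D'(1)]
        closed_sets[OF C'D'(2)] UNIV_sets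
      have "prob (UNIV - K') \<le> prob ((UNIV - K) \<union> (A \<union> (UNIV - (C' \<union> D'))))"
        using meas C'D'(3) by (intro finite_measure_mono) (auto simp: K'_def)
      also have "\<dots> \<le> prob (UNIV - K) + (prob A + prob (UNIV - (C' \<union> D')))"
        using meas
        by (intro order_trans[OF measure_Un_le] add_left_mono measure_Un_le) auto
      finally show ?thesis
        using K_le C'D'(5) \<open>prob A = 0\<close> by (simp add: K_def)
    qed
    have "compact ((K' \<times> K') \<inter> differ)"
      using \<open>closed K'\<close> \<open>closed differ\<close> by (intro compactI closed_Int closed_Times)
    moreover have "open (- agree B)" if "B \<in> G" for B
      using closed_agree[of B] that by auto
    \<comment> \<open>A pair in \<open>K'\<close> separated by \<open>E\<close> but by no member of
      \<open>G\<close> would have its first point in \<open>A\<close>. Compactness then leaves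
      finitely many separating events \<open>F\<close>.\<close>
    moreover have "(K' \<times> K') \<inter> differ \<subseteq> (\<Union>B\<in>G. - agree B)"
    proof
      fix p assume p: "p \<in> (K' \<times> K') \<inter> differ"
      then have "fst p \<notin> A"
        using C'D'(4) by (auto simp: K'_def)
      then show "p \<in> (\<Union>B\<in>G. - agree B)"
        using p by (auto simp: A_def K'_def image_iff)
    qed
    ultimately obtain F where F: "F \<subseteq> G" "finite F" "(K' \<times> K') \<inter> differ \<subseteq> (\<Union>B\<in>F. - agree B)"
      by (rule compactE_image)
    \<comment> \<open>The union of those cells of \<open>F\<close> that meet
      \<open>K' \<inter> E\<close>. Since \<open>F\<close> separates the points of \<open>K'\<close>
      inside \<open>E\<close> from those outside, \<open>E'\<close> and \<open>E\<close> coincide on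
      \<open>K'\<close>.\<close>
    define E' where "E' = {x. \<exists>y\<in>K' \<inter> E. \<forall>B\<in>F. x \<in> B \<longleftrightarrow> y \<in> B}"
    let ?name = "\<lambda>y. {B \<in> F. y \<in> B}"
    have "?name x = ?name y \<longleftrightarrow> (\<forall>B\<in>F. x \<in> B \<longleftrightarrow> y \<in> B)" for x y
      by blast
    then have "E' = (\<Union>S\<in>?name ` (K' \<inter> E). cell F S)"
      by (auto simp: E'_def cell_def)
    also have "\<dots> \<in> sets M"
    proof (rule sets.finite_UN)
      have "?name ` (K' \<inter> E) \<subseteq> Pow F" by blast
      then show "finite (?name ` (K' \<inter> E))"
        using F(2) by (simp add: finite_subset)
      show "cell F S \<in> sets M" for S
        using F G by (intro sets_cell) auto
    qed
    finally have "E' \<in> sets M" .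
    have "x \<in> E" if "x \<in> E'" "x \<in> K'" for x
    proof (rule ccontr)
      assume "x \<notin> E"
      obtain y where y: "y \<in> K'" "y \<in> E" "\<And>B. B \<in> F \<Longrightarrow> x \<in> B \<longleftrightarrow> y \<in> B"
        using \<open>x \<in> E'\<close> by (auto simp: E'_def)
      have K: "x \<in> K" "y \<in> K"
        using \<open>x \<in> K'\<close> y(1) by (simp_all add: K'_def)
      have "(x, y) \<in> differ"
        using differ_iff[OF K] y(2) \<open>x \<notin> E\<close> by simp
      then obtain B where B: "B \<in> F" "(x, y) \<notin> agree B"
        using F(3) \<open>x \<in> K'\<close> y(1) by blast
      moreover have "B \<in> ?H"
        using F(1) B(1) by blast
      ultimately show False
        using agree_iff[OF K, of B] y(3)[of B] by simp
    qed
    then have "(E - E') \<union> (E' - E) \<subseteq> UNIV - K'"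
      by (auto simp: E'_def)
    then have "prob ((E - E') \<union> (E' - E)) \<le> prob (UNIV - K')"
      using sets.compl_sets[OF closed_sets[OF \<open>closed K'\<close>]] by (intro finite_measure_mono) auto
    then have "prob ((E - E') \<union> (E' - E)) \<le> d"
      using K'_le by simp
    moreover have "\<forall>x y. x \<in> E' \<longrightarrow> (\<forall>D\<in>F. x \<in> D \<longleftrightarrow> y \<in> D) \<longrightarrow> y \<in> E'"
      unfolding E'_def by blast
    ultimately show ?thesis
      using F \<open>E' \<in> sets M\<close> by blast
  qed
  then have "\<exists>E' F. E' \<in> sets M \<and> finite F \<and> F \<subseteq> G
      \<and> (\<forall>x y. x \<in> E' \<longrightarrow> (\<forall>D\<in>F. x \<in> D \<longleftrightarrow> y \<in> D) \<longrightarrow> y \<in> E')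
      \<and> prob ((E - E') \<union> (E' - E)) \<le> inverse (real (Suc n))" for n
    by simp
  then obtain E' F where E': "\<And>n. E' n \<in> sets M" "\<And>n. finite (F n)" "\<And>n. F n \<subseteq> G"
    and det: "\<And>n x y. x \<in> E' n \<Longrightarrow> (\<And>D. D \<in> F n \<Longrightarrow> x \<in> D \<longleftrightarrow> y \<in> D) \<Longrightarrow> y \<in> E' n"
    and close: "\<And>n. prob ((E - E' n) \<union> (E' n - E)) \<le> inverse (real (Suc n))"
    by metis
  have "(\<lambda>n. prob ((E - E' n) \<union> (E' n - E))) \<longlonglongrightarrow> 0"
    using close by (intro Lim_null_comparison[OF _ LIMSEQ_inverse_real_of_nat]) auto
  then have "(\<lambda>n. family_entropy {E, E' n} - family_entropy {E' n}) \<longlonglongrightarrow> 0"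
    using E E' by (intro family_entropy_pair_tendsto_0)
  moreover have "cond_entropy {E} G \<le> family_entropy {E, E' n} - family_entropy {E' n}" for n
    using E G(2) E' by (intro cond_entropy_le_approximant[of _ _ "F n"]) (auto intro: det)
  ultimately have "cond_entropy {E} G \<le> 0"
    by (intro LIMSEQ_le_const) auto
  then show False using pos by simp
qed

section \<open>Asymptotic pairs\<close>

text \<open>For late \<open>i\<close> the preimages under \<open>T ^^ i\<close> of the members of
  \<open>Q n\<close> do not separate \<open>x\<close> from \<open>y\<close>, so both orbits visit a
  common member of \<open>Q n\<close> at time \<open>i\<close>.\<close>

lemma asymptotic_pairI_tail:
  fixes T :: "'a::metric_space \<Rightarrow> 'a"
  assumes cover: "\<And>n. \<Union>(Q n) = UNIV"
    and small: "\<And>n B u v. B \<in> Q n \<Longrightarrow> u \<in> B \<Longrightarrow> v \<in> B \<Longrightarrow> dist u v < 2 * inverse (real (Suc n))"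
    and tail: "\<And>n. \<exists>k. \<forall>i\<ge>k. (vimage (T ^^ i)) ` Q n \<subseteq> G"
    and agree: "\<And>D. D \<in> G \<Longrightarrow> x \<in> D \<longleftrightarrow> y \<in> D"
  shows "asymptotic_pair T x y"
  unfolding asymptotic_pair_def
proof (rule LIMSEQ_I)
  fix e :: real assume "0 < e"
  then obtain n where n: "inverse (real (Suc n)) < e / 2"
    using reals_Archimedean[of "e / 2"] by auto
  obtain k where k: "\<And>i. i \<ge> k \<Longrightarrow> (vimage (T ^^ i)) ` Q n \<subseteq> G"
    using tail by blast
  have "norm (dist ((T ^^ i) x) ((T ^^ i) y) - 0) < e" if "i \<ge> k" for i
  proof -
    obtain B where B: "B \<in> Q n" "(T ^^ i) x \<in> B"
      using cover[of n] by blast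
    then have "(T ^^ i) -` B \<in> G"
      using k[OF that] by blast
    then have "(T ^^ i) y \<in> B"
      using agree[of "(T ^^ i) -` B"] B by simp
    then show ?thesis
      using small[OF B] n by fastforce
  qed
  then show "\<exists>no. \<forall>i\<ge>no. norm (dist ((T ^^ i) x) ((T ^^ i) y) - 0) < e" by blast
qed

lemma exists_finite_ball_cover:
  assumes "compact (UNIV :: 'a::metric_space set)" "0 < r"
  shows "\<exists>Q :: 'a set set. finite Q \<and> \<Union>Q = UNIV
    \<and> (\<forall>B\<in>Q. open B \<and> (\<forall>u\<in>B. \<forall>v\<in>B. dist u v < 2 * r))"
proof -
  have "(UNIV :: 'a set) \<subseteq> (\<Union>x\<in>UNIV. ball x r)"
    using assms(2) by auto
  then obtain X where X: "finite X" "(UNIV :: 'a set) \<subseteq> (\<Union>x\<in>X. ball x r)"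
    using compactE_image[OF assms(1), of UNIV "\<lambda>x. ball x r"] by auto
  have "dist u v < 2 * r" if "u \<in> ball x r" "v \<in> ball x r" for x u v :: 'a
    using that dist_triangle3[of u v x] by simp
  then show ?thesis
    using X by (intro exI[of _ "(\<lambda>x. ball x r) ` X"]) auto
qed

text \<open>A partner \<open>y\<close> of \<open>T x\<close> has a preimage \<open>z\<close> because
  \<open>T\<close> is onto. The limit ignores the first term, and \<open>z\<close> differs from
  \<open>x\<close> because their images differ.\<close>

lemma proper_asymptotic_vimage_subset:
  assumes "surj T"
  shows "T -` {x. \<exists>y. proper_asymptotic_pair T x y} \<subseteq> {x. \<exists>y. proper_asymptotic_pair T x y}"
proof
  fix x assume "x \<in> T -` {x. \<exists>y. proper_asymptotic_pair T x y}"
  then obtain y where y: "asymptotic_pair T (T x) y" "T x \<noteq> y"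
    by (auto simp: proper_asymptotic_pair_def)
  obtain z where z: "y = T z"
    using assms by blast
  have "(\<lambda>n. dist ((T ^^ Suc n) x) ((T ^^ Suc n) z)) \<longlonglongrightarrow> 0"
    using y(1) by (simp add: asymptotic_pair_def z funpow_Suc_right del: funpow.simps)
  then have "asymptotic_pair T x z"
    unfolding asymptotic_pair_def by (rule LIMSEQ_imp_Suc)
  then show "x \<in> {x. \<exists>y. proper_asymptotic_pair T x y}"
    using y z by (auto simp: proper_asymptotic_pair_def)
qed

section \<open>From positive to full measure\<close>

text \<open>\<open>X\<close> is not assumed measurable, so ergodicity is applied to the set
  \<open>B\<close> of points that visit \<open>A\<close> infinitely often. It is invariant, its
  measure is at least that of \<open>A\<close>, and it lies in \<open>X\<close> because
  \<open>X\<close> contains all preimages of \<open>A\<close>.\<close>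

lemma (in surj_mpt) exists_full_measure_subset:
  assumes ergodic: "\<And>A. A \<in> sets M \<Longrightarrow> T -` A = A \<Longrightarrow> prob A = 0 \<or> prob A = 1"
    and A: "A \<in> sets M" "0 < prob A" "A \<subseteq> X" and X: "T -` X \<subseteq> X"
  obtains B where "B \<in> sets M" "B \<subseteq> X" "prob B = 1"
proof -
  define U where "U m = (\<Union>n. (T ^^ (m + n)) -` A)" for m
  have U_sets: "U m \<in> sets M" for m
    unfolding U_def using A vimage_funpow_sets by (intro sets.countable_UN) auto
  have U_Suc: "T -` U m = U (Suc m)" for m
    by (simp add: U_def vimage_UN vimage_funpow_Suc[symmetric] del: funpow.simps)
  have U_anti: "U (Suc m) \<subseteq> U m" for m
  proof
    fix x assume "x \<in> U (Suc m)"
    then obtain n where "x \<in> (T ^^ (Suc m + n)) -` A"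
      unfolding U_def by blast
    then have "x \<in> (T ^^ (m + Suc n)) -` A"
      by (simp only: add_Suc_shift)
    then show "x \<in> U m"
      unfolding U_def by blast
  qed
  then have "decseq U"
    by (rule decseq_SucI)
  have prob_le: "prob A \<le> prob (U m)" for m
  proof -
    have "(T ^^ (m + 0)) -` A \<subseteq> U m"
      unfolding U_def by blast
    then show ?thesis
      using finite_measure_mono[OF _ U_sets[of m]] prob_vimage_funpow[OF A(1), of m]
      by (metis add_0_right)
  qed
  define B where "B = (\<Inter>m. U m)"
  have "(\<lambda>m. prob (U m)) \<longlonglongrightarrow> prob B"
    unfolding B_def using U_sets \<open>decseq U\<close> by (intro finite_Lim_measure_decseq) auto
  then have "prob A \<le> prob B"
    using prob_le by (intro LIMSEQ_le_const) auto
  have "B \<in> sets M"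
    unfolding B_def using U_sets by (intro sets.countable_INT) auto
  moreover have "T -` B = B"
  proof -
    have "T -` B = (\<Inter>m. U (Suc m))"
      by (simp add: B_def vimage_INT U_Suc)
    also have "\<dots> = B"
      unfolding B_def using U_anti by blast
    finally show ?thesis .
  qed
  ultimately have "prob B = 1"
    using ergodic[of B] \<open>prob A \<le> prob B\<close> A by auto
  have "(T ^^ n) -` A \<subseteq> X" for n
  proof (induction n)
    case (Suc n)
    then have "(T ^^ Suc n) -` A \<subseteq> T -` X"
      by (auto simp: vimage_funpow_Suc simp del: funpow.simps)
    then show ?case using X by blast
  qed (use A in simp)
  then have "U 0 \<subseteq> X"
    unfolding U_def by (rule UN_least)
  then have "B \<subseteq> X"
    unfolding B_def by blast
  then show thesis using that \<open>B \<in> sets M\<close> \<open>prob B = 1\<close> by blast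
qed

lemma (in prob_space) completion_full_measure:
  assumes B: "B \<in> sets M" "prob B = 1" "B \<subseteq> X" and X: "X \<subseteq> space M"
  shows "X \<in> sets (completion M)" "emeasure (completion M) X = 1"
proof -
  have "space M - B \<in> null_sets M"
    using B prob_compl[of B] by (auto simp: null_sets_def emeasure_eq_measure)
  moreover have "X = B \<union> (X - B)" "X - B \<subseteq> space M - B"
    using B X by auto
  ultimately show sets: "X \<in> sets (completion M)"
    using sets_completionI[of X B "X - B" "space M - B" M] B(1) by simp
  interpret C: prob_space "completion M"
    by (rule prob_space_completion)
  have "1 = measure (completion M) B"
    using B by simp
  also have "\<dots> \<le> measure (completion M) X"
    using sets B by (intro C.finite_measure_mono)
  finally have "measure (completion M) X = 1"
    using C.prob_le_1[of X] by linarith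
  then show "emeasure (completion M) X = 1"
    unfolding C.emeasure_eq_measure by simp
qed

theorem proposition3:
  fixes T :: "'a::metric_space \<Rightarrow> 'a" and M :: "'a measure"
  assumes "compact (UNIV :: 'a set)"
    and "continuous_on UNIV T" and "surj T" and "\<not> inj T"
    and "ergodic_measure T M"
    and "measure_entropy M T > 0"
  shows "{x. \<exists>y. proper_asymptotic_pair T x y} \<in> sets (completion M) \<and>
         emeasure (completion M) {x. \<exists>y. proper_asymptotic_pair T x y} = 1"
proof -
  let ?X = "{x. \<exists>y. proper_asymptotic_pair T x y}"
  have sets: "sets M = sets borel" and "prob_space M"
    using assms(5) by (auto simp: ergodic_measure_def)
  have space: "space M = UNIV"
    using sets_eq_imp_space_eq[OF sets] by simp
  interpret surj_mpt M T
    using assms \<open>prob_space M\<close> space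
    by (auto simp: ergodic_measure_def surj_mpt_def surj_mpt_axioms_def prob_space_UNIV_def
        prob_space_UNIV_axioms_def)
  obtain P where P: "finite_measurable_partition M P" "0 < entropy_wrt M T P"
    using assms(6) by (auto simp: measure_entropy_def less_SUP_iff)
  then have P': "finite P" "P \<subseteq> sets M"
    by (auto simp: finite_measurable_partition_def)
  \<comment> \<open>Open covers suffice in place of partitions, since entropy is defined for
    arbitrary finite families of events.\<close>
  have "\<forall>n. \<exists>Q :: 'a set set. finite Q \<and> \<Union>Q = UNIV
      \<and> (\<forall>B\<in>Q. open B \<and> (\<forall>u\<in>B. \<forall>v\<in>B. dist u v < 2 * inverse (real (Suc n))))"
    by (intro allI exists_finite_ball_cover assms(1)) simp
  then obtain Q :: "nat \<Rightarrow> 'a set set" where "\<forall>n. finite (Q n) \<and> \<Union>(Q n) = UNIV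
      \<and> (\<forall>B\<in>Q n. open B \<and> (\<forall>u\<in>B. \<forall>v\<in>B. dist u v < 2 * inverse (real (Suc n))))"
    by (rule exE[OF choice])
  then have Q: "finite (Q n)" "\<Union>(Q n) = UNIV" "B \<in> Q n \<Longrightarrow> open B"
    "B \<in> Q n \<Longrightarrow> u \<in> B \<Longrightarrow> v \<in> B \<Longrightarrow> dist u v < 2 * inverse (real (Suc n))" for n B u v
    by blast+
  have Q_sets: "Q n \<subseteq> sets M" for n
    using Q(3) by (auto simp: sets)
  \<comment> \<open>A value strictly between 0 and the entropy leaves room for the losses in
    \<open>exists_tail_family\<close> and keeps the final bound positive.\<close>
  define c where "c = entropy_wrt M T P / 2"
  have c: "0 < c" "c < cond_entropy P (past P)"
    using P by (auto simp: c_def entropy_wrt_eq)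
  obtain G where G: "G \<subseteq> sets M" "countable G" "c \<le> cond_entropy P G"
    and tail: "\<forall>n. \<exists>k. \<forall>i\<ge>k. pre i (Q n) \<subseteq> G"
    using exists_tail_family[where Q = Q, OF P' c(2) Q(1) Q_sets] by blast
  obtain E where E: "E \<in> P" "0 < cond_entropy {E} G"
    using cond_entropy_pos_single[OF P' G(1)] c(1) G(3) by force
  have "E \<in> sets M"
    using E(1) P'(2) by blast
  obtain A where A: "closed A" "0 < prob A"
    "\<forall>x\<in>A. \<exists>y. x \<noteq> y \<and> (\<forall>D\<in>G. x \<in> D \<longleftrightarrow> y \<in> D)"
    using exists_indistinguishable_pairs[OF assms(1) prob_space_UNIV_axioms sets \<open>E \<in> sets M\<close> G(2,1) E(2)]
    by (elim exE conjE)
  have "A \<subseteq> ?X"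
  proof
    fix x assume "x \<in> A"
    then obtain y where y: "x \<noteq> y" "\<And>D. D \<in> G \<Longrightarrow> x \<in> D \<longleftrightarrow> y \<in> D"
      using A(3) by blast
    have "asymptotic_pair T x y"
      using Q(2,4) tail[unfolded pre_def, rule_format] y(2) by (rule asymptotic_pairI_tail)
    then show "x \<in> ?X"
      using y(1) by (auto simp: proper_asymptotic_pair_def)
  qed
  have ergodic: "prob B = 0 \<or> prob B = 1" if "B \<in> sets M" "T -` B = B" for B
    using assms(5) that by (simp add: ergodic_measure_def)
  have "A \<in> sets M"
    using A(1) by (simp add: sets)
  obtain B where B: "B \<in> sets M" "B \<subseteq> ?X" "prob B = 1"
    by (rule exists_full_measure_subset[OF ergodic \<open>A \<in> sets M\<close> A(2) \<open>A \<subseteq> ?X\<close>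
        proper_asymptotic_vimage_subset[OF assms(3)]])
  show ?thesis
    using completion_full_measure[OF B(1,3,2)] by simp
qed

end
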